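(* Let $\Sigma$ be a germ at $0$ of a closed subset of $\mathbb{R}^n$ with $0\in\Sigma$, let $r$ be a positive integer, $n\ge p$, and $f\in\mathcal{E}_{[r+1]}(n,p)$. If $f$ satisfies the second relative Kuo condition $(K^\delta_\Sigma)$ — i.e. for every $g\in\mathcal{E}_{[r+1]}(n,p)$ with $j^rg(\Sigma;0)=j^rf(\Sigma;0)$ there are $C,\alpha,\delta,\bar w>0$ (depending on $g$) such that $\kappa(df(x))\ge C\,d(x,\Sigma)^{r-\delta}$ for all $x\in\mathcal{H}^\Sigma_{r+1}(g;\bar w)\cap\{\|x\|<\alpha\}$ — then $j^rf(\Sigma;0)$ is $\Sigma$-$V$-sufficient in $\mathcal{E}_{[r+1]}(n,p)$.
   Context: $\mathcal{E}_{[s]}(n,p)$ is the set of germs at $0$ of $C^s$ maps $(\mathbb{R}^n,0)\to(\mathbb{R}^p,0)$. $j^rg(\Sigma;0)=j^rf(\Sigma;0)$ means the $r$-jets of $f,g$ coincide at every point of $\Sigma\cap U$ for some neighbourhood $U$ of $0$. Two germs $f,g$ are $\Sigma$-$V$-equivalent if the germs at $0$ of $f^{-1}(0)$ and $g^{-1}(0)$ are homeomorphic by a homeomorphism fixing $f^{-1}(0)\cap\Sigma$ pointwise; the relative jet is $\Sigma$-$V$-sufficient in $\mathcal{E}_{[s]}(n,p)$ if any two of its realisations there are $\Sigma$-$V$-equivalent. $d(x,\Sigma)$ is the distance to $\Sigma$. $\kappa(df(x))=\min_i\operatorname{dist}(\operatorname{grad}f_i(x),\operatorname{span}\{\operatorname{grad}f_j(x):j\ne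 i\})$. $\mathcal{H}^\Sigma_{d}(g;\bar w)=\{x:\|g(x)\|\le\bar w\,d(x,\Sigma)^{d}\}$. *)

theory Defs
  imports "HOL-Analysis.Analysis"
begin

text \<open>C^k maps on an open set: C^0 = continuous; C^(k+1) = differentiable with every
  directional derivative x \<mapsto> Df(x) v of class C^k (equivalent to the usual notion
  in finite dimensions).\<close>
primrec Ck_on :: "nat \<Rightarrow> ('a::real_normed_vector \<Rightarrow> 'b::real_normed_vector) \<Rightarrow> 'a set \<Rightarrow> bool" where
  "Ck_on 0 f U = continuous_on U f"
| "Ck_on (Suc k) f U =
     (f differentiable_on U \<and> (\<forall>v. Ck_on k (\<lambda>x. frechet_derivative f (at x) v) U))"

definition germ_Cs :: "nat \<Rightarrow> (real^'n \<Rightarrow> real^'p) \<Rightarrow> bool" where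
  "germ_Cs s f \<longleftrightarrow> f 0 = 0 \<and> (\<exists>U. open U \<and> 0 \<in> U \<and> Ck_on s f U)"

fun dderiv :: "('a::real_normed_vector \<Rightarrow> 'b::real_normed_vector) \<Rightarrow> 'a list \<Rightarrow> 'a \<Rightarrow> 'b" where
  "dderiv f [] = f"
| "dderiv f (v # vs) = (\<lambda>x. frechet_derivative (dderiv f vs) (at x) v)"

definition jet_eq_at :: "nat \<Rightarrow> ('a::real_normed_vector \<Rightarrow> 'b::real_normed_vector) \<Rightarrow> ('a \<Rightarrow> 'b) \<Rightarrow> 'a \<Rightarrow> bool" where
  "jet_eq_at r f g x \<longleftrightarrow> (\<forall>vs. length vs \<le> r \<longrightarrow> dderiv f vs x = dderiv g vs x)"

definition rel_jet_eq :: "nat \<Rightarrow> 'a::real_normed_vector set \<Rightarrow> ('a \<Rightarrow> 'b::real_normed_vector) \<Rightarrow> ('a \<Rightarrow> 'b) \<Rightarrow> bool" where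
  "rel_jet_eq r \<Sigma> g f \<longleftrightarrow> (\<exists>U. open U \<and> 0 \<in> U \<and> (\<forall>x \<in> \<Sigma> \<inter> U. jet_eq_at r g f x))"

definition grad_comp :: "(real^'n \<Rightarrow> real^'p) \<Rightarrow> 'p \<Rightarrow> real^'n \<Rightarrow> real^'n" where
  "grad_comp f i x = (\<chi> k. frechet_derivative f (at x) (axis k 1) $ i)"

definition kappa :: "(real^'n \<Rightarrow> real^'p) \<Rightarrow> real^'n \<Rightarrow> real" where
  "kappa f x = Min (range (\<lambda>i. infdist (grad_comp f i x) (span {grad_comp f j x | j. j \<noteq> i})))"

definition horn :: "'a::metric_space set \<Rightarrow> nat \<Rightarrow> ('a \<Rightarrow> 'b::real_normed_vector) \<Rightarrow> real \<Rightarrow> 'a set" where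
  "horn \<Sigma> d g w = {x. norm (g x) \<le> w * infdist x \<Sigma> ^ d}"

definition rel_kuo_delta :: "(real^'n) set \<Rightarrow> nat \<Rightarrow> (real^'n \<Rightarrow> real^'p) \<Rightarrow> bool" where
  "rel_kuo_delta \<Sigma> r f \<longleftrightarrow>
     (\<forall>g. germ_Cs (Suc r) g \<and> rel_jet_eq r \<Sigma> g f \<longrightarrow>
        (\<exists>C \<alpha> \<delta> w. C > 0 \<and> \<alpha> > 0 \<and> \<delta> > 0 \<and> w > 0 \<and>
           (\<forall>x \<in> horn \<Sigma> (Suc r) g w \<inter> {x. norm x < \<alpha>}.
              kappa f x \<ge> C * infdist x \<Sigma> powr (real r - \<delta>))))"

definition sigma_V_equiv :: "'a::real_normed_vector set \<Rightarrow> ('a \<Rightarrow> 'b::real_normed_vector) \<Rightarrow> ('a \<Rightarrow> 'b) \<Rightarrow> bool" where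
  "sigma_V_equiv \<Sigma> f g \<longleftrightarrow>
     (\<exists>U V h k. open U \<and> 0 \<in> U \<and> open V \<and> 0 \<in> V \<and>
        homeomorphism (f -` {0} \<inter> U) (g -` {0} \<inter> V) h k \<and>
        (\<forall>x \<in> f -` {0} \<inter> \<Sigma> \<inter> U. h x = x))"

definition sigma_V_sufficient :: "(real^'n) set \<Rightarrow> nat \<Rightarrow> nat \<Rightarrow> (real^'n \<Rightarrow> real^'p) \<Rightarrow> bool" where
  "sigma_V_sufficient \<Sigma> r s f \<longleftrightarrow>
     (\<forall>g1 g2. germ_Cs s g1 \<and> rel_jet_eq r \<Sigma> g1 f \<and> germ_Cs s g2 \<and> rel_jet_eq r \<Sigma> g2 f
        \<longrightarrow> sigma_V_equiv \<Sigma> g1 g2)"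

end

theory Submission
  imports Defs
begin

text \<open>
  Let \<open>g1\<close>, \<open>g2\<close> be two realisations, \<open>F t = (1 - t) g1 + t g2\<close>, \<open>P = g2 - g1\<close>, \<open>A = dF t\<close> and
  \<open>d = d(x, \<Sigma>)\<close>. By Taylor's formula \<open>P = O(d^(r+1))\<close> and \<open>dF t - df = O(d^r)\<close>. Since each \<open>F t\<close> is itself
  a realisation, the Kuo condition and compactness of \<open>[0,1]\<close> give \<open>|A\<^sup>T v| \<ge> d^r |v|\<close> on a horn
  \<open>|F t| \<le> w d^(r+1)\<close> with \<open>w\<close> independent of \<open>t\<close>.

  The field \<open>X = - A\<^sup>T l\<close>, where \<open>(A A\<^sup>T + |F t|) l = P\<close>, is then \<open>O(d)\<close> inside and outside the horn and
  Lipschitz away from \<open>\<Sigma>\<close>. By Gronwall's inequality its integral curves \<open>u\<close> never reach \<open>\<Sigma>\<close>, so that its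
  time-one flow is a homeomorphism near \<open>0\<close> fixing \<open>\<Sigma>\<close>. Along such a curve \<open>\<phi> t = F t (u t)\<close> satisfies
  \<open>\<phi>' = |\<phi>| l\<close>, hence the flow carries the zeros of \<open>g1\<close> to those of \<open>g2\<close>.
\<close>

section \<open>Gronwall inequality and existence for Lipschitz equations\<close>

text \<open>The obstacle is that \<open>A\<close> is known to have full rank only in the horn. The
  classical choice with \<open>A A\<^sup>T l = P\<close> would keep \<open>F t\<close> constant
  along curves, but it is available only there. Off the horn \<open>|F t|\<close> itself exceeds
  \<open>w d^(r+1)\<close>, so adding it to \<open>A A\<^sup>T\<close> restores solvability
  everywhere off \<Sigma> and replaces gluing by a cut-off. The price is that \<open>F t\<close>
  varies along curves. The defect, however, carries the factor \<open>|F t|\<close>, so zero stays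
  zero and nonzero stays nonzero.

  The exponent \<delta> serves to make \<open>d^(r-\<delta>)\<close> dominate the error
  \<open>O(d^r)\<close> between \<open>df\<close> and \<open>dF t\<close> close to 0, whatever its
  constant. Compactness in \<open>t\<close> works because \<open>F t - F s\<close> is bounded by
  \<open>|t - s| |P|\<close>, which has the order of the horn.

  The Lipschitz constants of \<open>X\<close> may blow up at \<Sigma>. Existence, uniqueness and
  continuity of the flow therefore combine two sources: comparison with Lipschitz fields away from
  \<Sigma>, and the linear growth bound at \<Sigma>.\<close>

lemma gronwall_norm:
  fixes u :: "real \<Rightarrow> 'a::real_inner"
  assumes der: "\<And>t. t \<in> {0..1} \<Longrightarrow> (u has_vector_derivative u' t) (at t within {0..1})"
    and bd: "\<And>t. t \<in> {0..1} \<Longrightarrow> norm (u' t) \<le> M * norm (u t)"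
    and t: "t \<in> {0..1}"
  shows "norm (u t) \<le> exp (M * t) * norm (u 0)"
    and "norm (u 0) \<le> exp (M * t) * norm (u t)"
proof -
  \<comment> \<open>The square is differentiated because the norm itself is not differentiable at
    zero.\<close>
  have dersq: "((\<lambda>s. u s \<bullet> u s) has_real_derivative 2 * (u s \<bullet> u' s)) (at s within {0..1})"
    if "s \<in> {0..1}" for s
  proof -
    have "((\<lambda>s. u s \<bullet> u s) has_derivative (\<lambda>h. u s \<bullet> (h *\<^sub>R u' s) + (h *\<^sub>R u' s) \<bullet> u s)) (at s within {0..1})"
      using der[OF that] unfolding has_vector_derivative_def
      by (intro has_derivative_inner) auto
    then show ?thesis
      unfolding has_field_derivative_def
      by (rule has_derivative_eq_rhs) (auto simp: inner_commute algebra_simps fun_eq_iff)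
  qed
  have cont: "continuous_on {0..t} (\<lambda>s. exp (c * s) * (u s \<bullet> u s))" for c
  proof -
    have "continuous_on {0..1} (\<lambda>s. u s \<bullet> u s)"
      by (rule DERIV_continuous_on[OF dersq])
    then have "continuous_on {0..t} (\<lambda>s. u s \<bullet> u s)"
      by (rule continuous_on_subset) (use t in auto)
    then show ?thesis
      by (intro continuous_on_mult continuous_on_exp continuous_on_const continuous_on_id)
  qed
  have derE: "((\<lambda>s. exp (c * s) * (u s \<bullet> u s)) has_real_derivative
      exp (c * s) * (c * (u s \<bullet> u s) + 2 * (u s \<bullet> u' s))) (at s)"
    if "0 < s" "s < t" for s c
  proof -
    have "at s within {0..1} = at s"
      using that t by (intro at_within_interior) auto
    then have "((\<lambda>s. u s \<bullet> u s) has_real_derivative 2 * (u s \<bullet> u' s)) (at s)"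
      using dersq[of s] that t by auto
    then show ?thesis
      by (auto intro!: derivative_eq_intros simp: algebra_simps)
  qed
  have cs: "\<bar>u s \<bullet> u' s\<bar> \<le> M * (u s \<bullet> u s)" if "s \<in> {0..1}" for s
  proof -
    have "\<bar>u s \<bullet> u' s\<bar> \<le> norm (u s) * norm (u' s)"
      by (rule Cauchy_Schwarz_ineq2)
    also have "\<dots> \<le> norm (u s) * (M * norm (u s))"
      by (intro mult_left_mono bd that) auto
    finally show ?thesis
      by (simp add: dot_square_norm power2_eq_square algebra_simps)
  qed
  have tt: "0 \<le> t" using t by simp
  \<comment> \<open>With the weight \<open>exp (-2 M s)\<close> the square is nonincreasing. With
    the weight \<open>exp (2 M s)\<close>, used below, it is nondecreasing, and this keeps a nonzero
    curve away from zero.\<close>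
  have "exp (-2*M * t) * (u t \<bullet> u t) \<le> exp (-2*M * 0) * (u 0 \<bullet> u 0)"
  proof (rule DERIV_nonpos_imp_decreasing_open[OF tt _ cont])
    fix s assume s: "0 < s" "s < t"
    have "(-2*M) * (u s \<bullet> u s) + 2 * (u s \<bullet> u' s) \<le> 0"
      using cs[of s] s t by auto
    then show "\<exists>y. DERIV (\<lambda>s. exp (-2*M * s) * (u s \<bullet> u s)) s :> y \<and> y \<le> 0"
      using derE[OF s, of "-2*M"] by (meson exp_ge_zero mult_nonneg_nonpos)
  qed
  then have "u t \<bullet> u t \<le> exp (2*M * t) * (u 0 \<bullet> u 0)"
    by (simp add: exp_minus field_simps)
  also have "\<dots> = (exp (M * t) * norm (u 0))\<^sup>2"
    by (simp add: power_mult_distrib dot_square_norm exp_double[symmetric] mult.assoc)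
  finally show "norm (u t) \<le> exp (M * t) * norm (u 0)"
    by (metis abs_le_square_iff abs_norm_cancel abs_of_nonneg dot_square_norm exp_ge_zero
        mult_nonneg_nonneg norm_ge_zero)
  have "exp (2*M * 0) * (u 0 \<bullet> u 0) \<le> exp (2*M * t) * (u t \<bullet> u t)"
  proof (rule DERIV_nonneg_imp_increasing_open[OF tt _ cont])
    fix s assume s: "0 < s" "s < t"
    have "0 \<le> (2*M) * (u s \<bullet> u s) + 2 * (u s \<bullet> u' s)"
      using cs[of s] s t by auto
    then show "\<exists>y. DERIV (\<lambda>s. exp (2*M * s) * (u s \<bullet> u s)) s :> y \<and> 0 \<le> y"
      using derE[OF s, of "2*M"] by (meson exp_ge_zero mult_nonneg_nonneg)
  qed
  then have "u 0 \<bullet> u 0 \<le> exp (2*M * t) * (u t \<bullet> u t)"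
    by simp
  also have "\<dots> = (exp (M * t) * norm (u t))\<^sup>2"
    by (simp add: power_mult_distrib dot_square_norm exp_double[symmetric] mult.assoc)
  finally show "norm (u 0) \<le> exp (M * t) * norm (u t)"
    by (metis abs_le_square_iff abs_norm_cancel abs_of_nonneg dot_square_norm exp_ge_zero
        mult_nonneg_nonneg norm_ge_zero)
qed

text \<open>The Picard operator becomes a contraction after rescaling the unknown curve by \<open>exp (2 N t)\<close>.\<close>
lemma lipschitz_ode_solution_exists:
  fixes Y :: "real \<Rightarrow> 'a::euclidean_space \<Rightarrow> 'a"
  assumes lip: "\<And>t s x y. \<lbrakk>t \<in> {0..1}; s \<in> {0..1}\<rbrakk> \<Longrightarrow>
      norm (Y t x - Y s y) \<le> M * (\<bar>t - s\<bar> + norm (x - y))"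
  shows "\<exists>u. u 0 = x0 \<and> (\<forall>t\<in>{0..1}. (u has_vector_derivative Y t (u t)) (at t within {0..1}))"
proof -
  define N where "N = \<bar>M\<bar> + 1"
  have N: "N > 0" by (simp add: N_def)
  have lipN: "norm (Y t x - Y s y) \<le> N * (\<bar>t - s\<bar> + norm (x - y))"
    if "t \<in> {0..1}" "s \<in> {0..1}" for t s x y
  proof -
    have "M * (\<bar>t - s\<bar> + norm (x - y)) \<le> N * (\<bar>t - s\<bar> + norm (x - y))"
      by (intro mult_right_mono) (auto simp: N_def)
    with lip[OF that] show ?thesis by (meson order_trans)
  qed
  have contY: "continuous_on {0..1} (\<lambda>s. Y s (w s))" if "continuous_on {0..1} w" for w
    unfolding continuous_on_def
  proof
    fix x :: real assume x: "x \<in> {0..1}"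
    have w: "(w \<longlongrightarrow> w x) (at x within {0..1})"
      using that x by (auto simp: continuous_on_def)
    have *: "((\<lambda>s. N * (\<bar>s - x\<bar> + norm (w s - w x))) \<longlongrightarrow> 0) (at x within {0..1})"
      by (rule tendsto_eq_intros refl w | simp)+
    have "((\<lambda>s. Y s (w s) - Y x (w x)) \<longlongrightarrow> 0) (at x within {0..1})"
      using lipN x by (intro Lim_null_comparison[OF _ *]) (auto simp: eventually_at_filter)
    then show "((\<lambda>s. Y s (w s)) \<longlongrightarrow> Y x (w x)) (at x within {0..1})"
      by (simp add: LIM_zero_iff)
  qed
  define G where "G z s = Y s (exp (2 * N * s) *\<^sub>R apply_bcontfun z s)" for z :: "(real, 'a) bcontfun" and s
  define I where "I z t = x0 + integral {0..t} (G z)" for z t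
  \<comment> \<open>Clamping time to the unit interval extends a curve to a bounded continuous
    function on the whole line. The Picard operator then acts on the complete space
    \<open>bcontfun\<close>.\<close>
  define cl :: "real \<Rightarrow> real" where "cl t = max 0 (min 1 t)" for t
  define W where "W z t = exp (-2 * N * cl t) *\<^sub>R I z (cl t)" for z t
  define T where "T z = Bcontfun (W z)" for z
  have cl: "cl t \<in> {0..1}" "t \<in> {0..1} \<Longrightarrow> cl t = t" for t
    by (auto simp: cl_def)
  have contG: "continuous_on {0..1} (G z)" for z
    unfolding G_def by (intro contY continuous_intros) simp
  have derI: "(I z has_vector_derivative G z t) (at t within {0..1})" if "t \<in> {0..1}" for z t
    unfolding I_def
    using integral_has_vector_derivative[OF contG that]
    by (auto intro!: derivative_eq_intros)
  have contI: "continuous_on {0..1} (I z)" for z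
    unfolding continuous_on_eq_continuous_within
    using derI has_vector_derivative_continuous by blast
  have contcl: "continuous_on UNIV cl"
    unfolding cl_def by (intro continuous_intros)
  have contIcl: "continuous_on UNIV (\<lambda>t. I z (cl t))" for z
    by (rule continuous_on_compose2[OF contI contcl]) (use cl in auto)
  have Win: "W z \<in> bcontfun" for z
  proof -
    have 1: "continuous_on UNIV (W z)"
      unfolding W_def by (intro continuous_intros contcl contIcl)
    have "W z = W z \<circ> cl"
      unfolding W_def using cl by (auto simp: fun_eq_iff)
    then have "range (W z) \<subseteq> W z ` {0..1}"
      using cl(1) by (metis image_comp image_mono image_subsetI)
    moreover have "bounded (W z ` {0..1})"
      by (intro compact_imp_bounded compact_continuous_image continuous_on_subset[OF 1]) auto
    ultimately show ?thesis
      using 1 by (auto simp: bcontfun_def intro: bounded_subset)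
  qed
  have Tapp: "apply_bcontfun (T z) = W z" for z
    unfolding T_def using Win by (simp add: Bcontfun_inverse)
  \<comment> \<open>The integral of \<open>N exp (2 N s) D\<close> up to \<tau> is
    \<open>(exp (2 N \<tau>) - 1) D / 2\<close>; the rescaling by \<open>exp (-2 N \<tau>)\<close>
    leaves at most \<open>D / 2\<close>.\<close>
  have contr: "dist (T z) (T z') \<le> (1/2) * dist z z'" for z z'
  proof (rule dist_bound)
    fix t
    define \<tau> where "\<tau> = cl t"
    have \<tau>: "\<tau> \<in> {0..1}" using cl by (simp add: \<tau>_def)
    define D where "D = dist z z'"
    have intG: "G z integrable_on {0..\<tau>}" for z
      using \<tau> by (intro integrable_continuous_real continuous_on_subset[OF contG]) auto
    have expint: "((\<lambda>s. N * exp (2 * N * s) * D) has_integral (exp (2 * N * \<tau>) * D / 2 - exp (2 * N * 0) * D / 2)) {0..\<tau>}"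
    proof (rule fundamental_theorem_of_calculus)
      show "0 \<le> \<tau>" using \<tau> by simp
      fix s assume "s \<in> {0..\<tau>}"
      show "((\<lambda>s. exp (2 * N * s) * D / 2) has_vector_derivative N * exp (2 * N * s) * D) (at s within {0..\<tau>})"
        unfolding has_real_derivative_iff_has_vector_derivative[symmetric]
        by (auto intro!: derivative_eq_intros)
    qed
    have "norm (I z \<tau> - I z' \<tau>) = norm (integral {0..\<tau>} (\<lambda>s. G z s - G z' s))"
      using integral_diff[OF intG intG, of z z'] by (simp add: I_def)
    also have "\<dots> \<le> integral {0..\<tau>} (\<lambda>s. N * exp (2 * N * s) * D)"
    proof (rule integral_norm_bound_integral)
      show "(\<lambda>s. G z s - G z' s) integrable_on {0..\<tau>}"
        by (intro integrable_diff intG)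
      show "(\<lambda>s. N * exp (2 * N * s) * D) integrable_on {0..\<tau>}"
        using expint by blast
      fix s assume "s \<in> {0..\<tau>}"
      then have s: "s \<in> {0..1}" using \<tau> by auto
      have "norm (G z s - G z' s) \<le> N * (\<bar>s - s\<bar> + norm (exp (2 * N * s) *\<^sub>R apply_bcontfun z s - exp (2 * N * s) *\<^sub>R apply_bcontfun z' s))"
        unfolding G_def by (intro lipN s)
      also have "\<dots> = N * (exp (2 * N * s) * dist (apply_bcontfun z s) (apply_bcontfun z' s))"
        by (simp add: scaleR_diff_right[symmetric] dist_norm)
      also have "\<dots> \<le> N * (exp (2 * N * s) * D)"
        unfolding D_def by (intro mult_left_mono dist_bounded) (use N in auto)
      finally show "norm (G z s - G z' s) \<le> N * exp (2 * N * s) * D"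
        by (simp add: mult.assoc)
    qed
    also have "\<dots> = (exp (2 * N * \<tau>) - 1) * D / 2"
      using integral_unique[OF expint] by (simp add: field_simps)
    finally have "norm (I z \<tau> - I z' \<tau>) \<le> (exp (2 * N * \<tau>) - 1) * D / 2" .
    moreover have "(exp (2 * N * \<tau>) - 1) * D / 2 \<le> exp (2 * N * \<tau>) * (D / 2)"
      by (simp add: D_def algebra_simps)
    ultimately have *: "norm (I z \<tau> - I z' \<tau>) \<le> exp (2 * N * \<tau>) * (D / 2)" by simp
    have "dist (W z t) (W z' t) = exp (-2 * N * \<tau>) * norm (I z \<tau> - I z' \<tau>)"
      by (simp add: W_def dist_norm \<tau>_def scaleR_diff_right[symmetric])
    also have "\<dots> \<le> exp (-2 * N * \<tau>) * (exp (2 * N * \<tau>) * (D / 2))"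
      by (intro mult_left_mono *) auto
    also have "\<dots> = D / 2"
      by (simp add: exp_minus)
    finally show "dist (apply_bcontfun (T z) t) (apply_bcontfun (T z') t) \<le> (1/2) * dist z z'"
      by (simp add: Tapp D_def)
  qed
  obtain z where z: "T z = z"
    using banach_fix_type[of "1/2" T] contr by auto
  define u where "u = I z"
  have zt: "exp (2 * N * t) *\<^sub>R apply_bcontfun z t = u t" if "t \<in> {0..1}" for t
  proof -
    have "apply_bcontfun z t = exp (-2 * N * t) *\<^sub>R u t"
      using Tapp[of z] cl(2)[OF that] by (simp add: z W_def u_def)
    then show ?thesis
      by (simp add: exp_minus)
  qed
  show ?thesis
  proof (intro exI conjI ballI)
    show "u 0 = x0"
      by (simp add: u_def I_def)
    fix t :: real assume t: "t \<in> {0..1}"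
    show "(u has_vector_derivative Y t (u t)) (at t within {0..1})"
      using derI[OF t, of z] zt[OF t] by (simp add: G_def u_def)
  qed
qed

section \<open>Flows of vector fields vanishing on a closed set\<close>

lemma exp_mult_exp_minus: "exp a * (exp (- a) * b) = (b::real)"
  by (simp add: exp_minus)

text \<open>Confinement to the ball of radius \<rho> is part of the notion, since all hypotheses on
  the field are restricted to that ball.\<close>

definition traj :: "real \<Rightarrow> (real \<Rightarrow> 'a \<Rightarrow> 'a) \<Rightarrow> (real \<Rightarrow> 'a::real_normed_vector) \<Rightarrow> bool" where
  "traj \<rho> X u \<longleftrightarrow>
     (\<forall>t\<in>{0..1}. norm (u t) \<le> \<rho> \<and> (u has_vector_derivative X t (u t)) (at t within {0..1}))"

lemma trajD:
  assumes "traj \<rho> X u" "t \<in> {0..1}"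
  shows "u t \<in> cball 0 \<rho>" "(u has_vector_derivative X t (u t)) (at t within {0..1})"
  using assms by (auto simp: traj_def)

lemma traj_reverse:
  assumes "traj \<rho> X u"
  shows "traj \<rho> (\<lambda>t x. - X (1 - t) x) (\<lambda>t. u (1 - t))"
  unfolding traj_def
proof (intro ballI conjI)
  fix t :: real assume t: "t \<in> {0..1}"
  then have t': "1 - t \<in> {0..1}" by auto
  show "norm (u (1 - t)) \<le> \<rho>"
    using trajD(1)[OF assms t'] by simp
  have img: "(\<lambda>t. 1 - t) ` {0..1::real} = {0..1}"
    by (simp add: image_diff_atLeastAtMost)
  have "(u \<circ> (\<lambda>t. 1 - t) has_vector_derivative (-1) *\<^sub>R X (1 - t) (u (1 - t))) (at t within {0..1})"
  proof (rule vector_diff_chain_within)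
    show "((\<lambda>t. 1 - t) has_vector_derivative - 1) (at t within {0..1})"
      by (auto intro!: derivative_eq_intros)
    show "(u has_vector_derivative X (1 - t) (u (1 - t))) (at (1 - t) within (\<lambda>t. 1 - t) ` {0..1})"
      unfolding img by (rule trajD(2)[OF assms t'])
  qed
  then show "((\<lambda>t. u (1 - t)) has_vector_derivative - X (1 - t) (u (1 - t))) (at t within {0..1})"
    by (simp add: o_def)
qed

text \<open>The time-dependent vector field \<^term>\<open>X\<close> is only Lipschitz away from \<^term>\<open>S\<close>, with constants that may
  blow up at \<^term>\<open>S\<close>; the growth bound keeps integral curves off \<^term>\<open>S\<close>.\<close>
locale relative_field =
  fixes S :: "'a::euclidean_space set" and \<rho> L :: real and X :: "real \<Rightarrow> 'a \<Rightarrow> 'a"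
  assumes S: "closed S" "0 \<in> S"
    and \<rho>: "\<rho> > 0"
    and growth: "\<And>t x. \<lbrakk>t \<in> {0..1}; x \<in> cball 0 \<rho>\<rbrakk> \<Longrightarrow> norm (X t x) \<le> L * infdist x S"
    and L: "L \<ge> 0"
    and approx: "\<And>\<epsilon>. \<epsilon> > 0 \<Longrightarrow> \<exists>M Y.
      (\<forall>t\<in>{0..1}. \<forall>s\<in>{0..1}. \<forall>x\<in>cball 0 \<rho>. \<forall>y\<in>cball 0 \<rho>.
         norm (Y t x - Y s y) \<le> M * (\<bar>t - s\<bar> + norm (x - y))) \<and>
      (\<forall>t\<in>{0..1}. \<forall>x\<in>cball 0 \<rho>. norm (Y t x) \<le> L * infdist x S) \<and>
      (\<forall>t\<in>{0..1}. \<forall>x\<in>cball 0 \<rho>. \<epsilon> \<le> infdist x S \<longrightarrow> Y t x = X t x)"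
begin

text \<open>Time reversal stays within the same class of fields. The inverse of the time-one map is
  thus again a time-one map, and its continuity comes for free.\<close>

lemma reverse: "relative_field S \<rho> L (\<lambda>t x. - X (1 - t) x)"
proof
  show "closed S" "0 \<in> S" "\<rho> > 0" "L \<ge> 0"
    by (fact S \<rho> L)+
  show "norm (- X (1 - t) x) \<le> L * infdist x S" if "t \<in> {0..1}" "x \<in> cball 0 \<rho>" for t x
    using growth[of "1 - t" x] that by auto
  fix \<epsilon> :: real assume "\<epsilon> > 0"
  from approx[OF this] obtain M Y where
    1: "\<And>t s x y. \<lbrakk>t \<in> {0..1}; s \<in> {0..1}; x \<in> cball 0 \<rho>; y \<in> cball 0 \<rho>\<rbrakk> \<Longrightarrow>
         norm (Y t x - Y s y) \<le> M * (\<bar>t - s\<bar> + norm (x - y))" and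
    2: "\<And>t x. \<lbrakk>t \<in> {0..1}; x \<in> cball 0 \<rho>\<rbrakk> \<Longrightarrow> norm (Y t x) \<le> L * infdist x S" and
    3: "\<And>t x. \<lbrakk>t \<in> {0..1}; x \<in> cball 0 \<rho>; \<epsilon> \<le> infdist x S\<rbrakk> \<Longrightarrow> Y t x = X t x"
    by blast
  let ?Y = "\<lambda>t x. - Y (1 - t) x"
  have "norm (?Y t x - ?Y s y) \<le> M * (\<bar>t - s\<bar> + norm (x - y))"
    if "t \<in> {0..1}" "s \<in> {0..1}" "x \<in> cball 0 \<rho>" "y \<in> cball 0 \<rho>" for t s x y
  proof -
    have "norm (?Y t x - ?Y s y) = norm (Y (1 - t) x - Y (1 - s) y)"
      by (simp add: norm_minus_commute)
    also have "\<dots> \<le> M * (\<bar>(1 - t) - (1 - s)\<bar> + norm (x - y))"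
      using that by (intro 1) auto
    finally show ?thesis
      by (simp add: abs_minus_commute)
  qed
  moreover have "norm (?Y t x) \<le> L * infdist x S" if "t \<in> {0..1}" "x \<in> cball 0 \<rho>" for t x
    using 2[of "1 - t" x] that by auto
  moreover have "?Y t x = - X (1 - t) x" if "t \<in> {0..1}" "x \<in> cball 0 \<rho>" "\<epsilon> \<le> infdist x S" for t x
    using 3[of "1 - t" x] that by auto
  ultimately show "\<exists>M Y.
      (\<forall>t\<in>{0..1}. \<forall>s\<in>{0..1}. \<forall>x\<in>cball 0 \<rho>. \<forall>y\<in>cball 0 \<rho>.
         norm (Y t x - Y s y) \<le> M * (\<bar>t - s\<bar> + norm (x - y))) \<and>
      (\<forall>t\<in>{0..1}. \<forall>x\<in>cball 0 \<rho>. norm (Y t x) \<le> L * infdist x S) \<and>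
      (\<forall>t\<in>{0..1}. \<forall>x\<in>cball 0 \<rho>. \<epsilon> \<le> infdist x S \<longrightarrow> Y t x = - X (1 - t) x)"
    by (intro exI[of _ M] exI[of _ ?Y] conjI ballI impI) auto
qed

lemma exp_L_mono: "t \<in> {0..1} \<Longrightarrow> exp (L * t) \<le> exp L"
  using L by (simp add: mult_left_le)

text \<open>Since \<^term>\<open>infdist x S \<le> norm (x - y)\<close>, Gronwall's inequality applies to \<^term>\<open>u - y\<close> for each single
  \<^term>\<open>y \<in> S\<close>, although \<^term>\<open>infdist x S\<close> need not be differentiable.\<close>
lemma curve_dist:
  fixes u :: "real \<Rightarrow> 'a"
  assumes der: "\<And>t. t \<in> {0..1} \<Longrightarrow> (u has_vector_derivative u' t) (at t within {0..1})"
    and bd: "\<And>t. t \<in> {0..1} \<Longrightarrow> norm (u' t) \<le> L * norm (u t - y)"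
    and t: "t \<in> {0..1}"
  shows "norm (u t - y) \<le> exp L * norm (u 0 - y)" "norm (u 0 - y) \<le> exp L * norm (u t - y)"
proof -
  have d: "((\<lambda>t. u t - y) has_vector_derivative u' t) (at t within {0..1})" if "t \<in> {0..1}" for t
    using der[OF that] by (auto intro!: derivative_eq_intros)
  note g = gronwall_norm[where u = "\<lambda>t. u t - y", OF d bd t]
  have "exp (L * t) * norm (u 0 - y) \<le> exp L * norm (u 0 - y)"
    by (intro mult_right_mono exp_L_mono t) auto
  with g(1) show "norm (u t - y) \<le> exp L * norm (u 0 - y)" by linarith
  have "exp (L * t) * norm (u t - y) \<le> exp L * norm (u t - y)"
    by (intro mult_right_mono exp_L_mono t) auto
  with g(2) show "norm (u 0 - y) \<le> exp L * norm (u t - y)" by linarith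
qed

lemma infdist_le_norm: "y \<in> S \<Longrightarrow> infdist x S \<le> norm (x - y)"
  by (metis dist_norm infdist_le)

lemma traj_dist:
  assumes "traj \<rho> X u" "y \<in> S" "t \<in> {0..1}"
  shows "norm (u t - y) \<le> exp L * norm (u 0 - y)" "norm (u 0 - y) \<le> exp L * norm (u t - y)"
proof -
  have *: "norm (X t (u t)) \<le> L * norm (u t - y)" if "t \<in> {0..1}" for t
    using growth[OF that trajD(1)[OF assms(1) that]]
      mult_left_mono[OF infdist_le_norm[OF assms(2), of "u t"] L] by linarith
  show "norm (u t - y) \<le> exp L * norm (u 0 - y)" "norm (u 0 - y) \<le> exp L * norm (u t - y)"
    using curve_dist[OF trajD(2)[OF assms(1)] * assms(3)] by auto
qed

lemma infdist_le_exp_infdist: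
  assumes "\<And>y. y \<in> S \<Longrightarrow> norm (a - y) \<le> exp L * norm (b - y)"
  shows "exp (- L) * infdist a S \<le> infdist b S"
proof -
  have "S \<noteq> {}" using S by auto
  from infdist_attains_inf[OF S(1) this] obtain y where y: "y \<in> S" "infdist b S = dist b y"
    by blast
  have "infdist a S \<le> exp L * norm (b - y)"
    using infdist_le_norm[OF y(1), of a] assms[OF y(1)] by linarith
  then show ?thesis
    using y by (simp add: exp_minus dist_norm field_simps)
qed

lemma traj_infdist:
  assumes "traj \<rho> X u" "t \<in> {0..1}"
  shows "exp (- L) * infdist (u 0) S \<le> infdist (u t) S"
  using traj_dist(2)[OF assms(1) _ assms(2)] by (rule infdist_le_exp_infdist)

lemma traj_const:
  assumes "traj \<rho> X u" "u 0 \<in> S" "t \<in> {0..1}"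
  shows "u t = u 0"
  using traj_dist(1)[OF assms] by simp

text \<open>Curves starting at distance at least \<epsilon> from \<open>S\<close> stay at distance
  at least \<open>exp (- L) * \<epsilon>\<close>. There the field agrees with a Lipschitz one, whose
  constant depends on \<epsilon> only, and Gronwall's inequality applies to the difference of two
  curves.\<close>

lemma traj_lipschitz:
  assumes "\<epsilon> > 0"
  shows "\<exists>M. \<forall>u v. traj \<rho> X u \<and> traj \<rho> X v \<and> \<epsilon> \<le> infdist (u 0) S \<and> \<epsilon> \<le> infdist (v 0) S \<longrightarrow>
    norm (u 1 - v 1) \<le> exp M * norm (u 0 - v 0)"
proof -
  have "exp (- L) * \<epsilon> > 0" using assms by simp
  from approx[OF this] obtain M Y where
    lip: "\<And>t s x y. \<lbrakk>t \<in> {0..1}; s \<in> {0..1}; x \<in> cball 0 \<rho>; y \<in> cball 0 \<rho>\<rbrakk> \<Longrightarrow>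
         norm (Y t x - Y s y) \<le> M * (\<bar>t - s\<bar> + norm (x - y))" and
    eq: "\<And>t x. \<lbrakk>t \<in> {0..1}; x \<in> cball 0 \<rho>; exp (- L) * \<epsilon> \<le> infdist x S\<rbrakk> \<Longrightarrow> Y t x = X t x"
    by blast
  have "norm (u 1 - v 1) \<le> exp M * norm (u 0 - v 0)"
    if u: "traj \<rho> X u" "\<epsilon> \<le> infdist (u 0) S" and v: "traj \<rho> X v" "\<epsilon> \<le> infdist (v 0) S" for u v
  proof -
    have XY: "Y t (w t) = X t (w t)" if "traj \<rho> X w" "\<epsilon> \<le> infdist (w 0) S" "t \<in> {0..1}" for w t
    proof (rule eq[OF that(3) trajD(1)[OF that(1,3)]])
      have "exp (- L) * \<epsilon> \<le> exp (- L) * infdist (w 0) S"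
        by (intro mult_left_mono that) auto
      then show "exp (- L) * \<epsilon> \<le> infdist (w t) S"
        using traj_infdist[OF that(1,3)] by linarith
    qed
    have "norm (u 1 - v 1) \<le> exp (M * 1) * norm (u 0 - v 0)"
    proof (rule gronwall_norm(1)[where u = "\<lambda>t. u t - v t" and u' = "\<lambda>t. X t (u t) - X t (v t)"])
      fix t :: real assume t: "t \<in> {0..1}"
      show "((\<lambda>t. u t - v t) has_vector_derivative X t (u t) - X t (v t)) (at t within {0..1})"
        using trajD(2)[OF u(1) t] trajD(2)[OF v(1) t] by (intro has_vector_derivative_diff)
      show "norm (X t (u t) - X t (v t)) \<le> M * norm (u t - v t)"
        using lip[OF t t trajD(1)[OF u(1) t] trajD(1)[OF v(1) t]] XY[OF u t] XY[OF v t] by simp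
    qed simp
    then show ?thesis by simp
  qed
  then show ?thesis by blast
qed

lemma infdist_pos: "x \<notin> S \<Longrightarrow> infdist x S > 0"
  using S infdist_pos_not_in_closed by blast

text \<open>On \<open>S\<close>, where no Lipschitz condition is at hand, uniqueness comes from the
  growth bound, which makes curves constant.\<close>

lemma traj_unique:
  assumes "traj \<rho> X u" "traj \<rho> X v" "u 0 = v 0"
  shows "u 1 = v 1"
proof (cases "u 0 \<in> S")
  case True
  then show ?thesis
    using traj_const[OF assms(1), of 1] traj_const[OF assms(2), of 1] assms(3) by auto
next
  case False
  from traj_lipschitz[OF infdist_pos[OF False]] obtain M where
    "\<And>v. \<lbrakk>traj \<rho> X v; infdist (u 0) S \<le> infdist (v 0) S\<rbrakk> \<Longrightarrow>
      norm (u 1 - v 1) \<le> exp M * norm (u 0 - v 0)"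
    using assms(1) by blast
  from this[OF assms(2)] assms(3) show ?thesis by simp
qed

lemma traj_exists:
  assumes "norm x0 \<le> exp (- L) * \<rho>"
  shows "\<exists>u. traj \<rho> X u \<and> u 0 = x0"
proof (cases "x0 \<in> S")
  case True
  have x0: "norm x0 \<le> \<rho>"
    using assms L \<rho> by (smt (verit) exp_le_one_iff mult_left_le_one_le exp_ge_zero)
  have "X t x0 = 0" if "t \<in> {0..1}" for t
    using growth[OF that, of x0] x0 True by simp
  then have "traj \<rho> X (\<lambda>_. x0)"
    using x0 by (auto simp: traj_def)
  then show ?thesis by blast
next
  case False
  \<comment> \<open>The distance to \<open>S\<close> that a curve from \<open>x0\<close> cannot fall
    below. The solution for the approximating field is therefore one for \<open>X\<close>.\<close>
  define \<epsilon> where "\<epsilon> = exp (- L) * infdist x0 S"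
  have "\<epsilon> > 0" using infdist_pos[OF False] by (simp add: \<epsilon>_def)
  from approx[OF this] obtain M Y where
    lip: "\<And>t s x y. \<lbrakk>t \<in> {0..1}; s \<in> {0..1}; x \<in> cball 0 \<rho>; y \<in> cball 0 \<rho>\<rbrakk> \<Longrightarrow>
         norm (Y t x - Y s y) \<le> M * (\<bar>t - s\<bar> + norm (x - y))" and
    gr: "\<And>t x. \<lbrakk>t \<in> {0..1}; x \<in> cball 0 \<rho>\<rbrakk> \<Longrightarrow> norm (Y t x) \<le> L * infdist x S" and
    eq: "\<And>t x. \<lbrakk>t \<in> {0..1}; x \<in> cball 0 \<rho>; \<epsilon> \<le> infdist x S\<rbrakk> \<Longrightarrow> Y t x = X t x"
    by blast
  \<comment> \<open>The nearest-point projection onto the ball extends the field to the whole space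
    with control of its Lipschitz constant. It disappears again once the curve is known to stay in
    the ball; that is what the factor \<open>exp (- L)\<close> in the bound on \<open>x0\<close>
    ensures.\<close>
  define \<pi> :: "'a \<Rightarrow> 'a" where "\<pi> = closest_point (cball 0 \<rho>)"
  have \<pi>: "\<pi> x \<in> cball 0 \<rho>" for x
    unfolding \<pi>_def by (rule closest_point_in_set) (use \<rho> in auto)
  have \<pi>_id: "\<pi> x = x" if "norm x \<le> \<rho>" for x
    unfolding \<pi>_def using that by (simp add: closest_point_self)
  have \<pi>_lip: "norm (\<pi> x - \<pi> y) \<le> norm (x - y)" for x y
    unfolding \<pi>_def dist_norm[symmetric] by (rule closest_point_lipschitz) (use \<rho> in auto)
  have "norm (Y t (\<pi> x) - Y s (\<pi> y)) \<le> \<bar>M\<bar> * (\<bar>t - s\<bar> + norm (x - y))"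
    if "t \<in> {0..1}" "s \<in> {0..1}" for t s x y
  proof -
    have "norm (Y t (\<pi> x) - Y s (\<pi> y)) \<le> M * (\<bar>t - s\<bar> + norm (\<pi> x - \<pi> y))"
      by (intro lip that \<pi>)
    also have "\<dots> \<le> \<bar>M\<bar> * (\<bar>t - s\<bar> + norm (x - y))"
      by (intro mult_mono add_left_mono \<pi>_lip) auto
    finally show ?thesis .
  qed
  from lipschitz_ode_solution_exists[of "\<lambda>t x. Y t (\<pi> x)" "\<bar>M\<bar>" x0, OF this] obtain u where
    u0: "u 0 = x0" and
    u: "\<And>t. t \<in> {0..1} \<Longrightarrow> (u has_vector_derivative Y t (\<pi> (u t))) (at t within {0..1})"
    by auto
  have in_ball: "norm (u t) \<le> \<rho>" if t: "t \<in> {0..1}" for t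
  proof -
    have "norm (Y t (\<pi> (u t))) \<le> L * norm (u t - 0)" if t: "t \<in> {0..1}" for t
    proof -
      have "norm (Y t (\<pi> (u t))) \<le> L * infdist (\<pi> (u t)) S"
        by (intro gr t \<pi>)
      also have "\<dots> \<le> L * norm (\<pi> (u t) - \<pi> 0)"
        using infdist_le_norm[OF S(2)] \<pi>_id[of 0] \<rho> L by (intro mult_left_mono) auto
      also have "\<dots> \<le> L * norm (u t - 0)"
        by (intro mult_left_mono \<pi>_lip L)
      finally show ?thesis .
    qed
    from curve_dist(1)[OF u this t] have "norm (u t) \<le> exp L * norm x0"
      by (simp add: u0)
    also have "\<dots> \<le> exp L * (exp (- L) * \<rho>)"
      by (intro mult_left_mono assms) auto
    finally show ?thesis
      by (simp add: exp_mult_exp_minus)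
  qed
  then have u': "(u has_vector_derivative Y t (u t)) (at t within {0..1})" if "t \<in> {0..1}" for t
    using u[OF that] \<pi>_id that by simp
  have far: "\<epsilon> \<le> infdist (u t) S" if t: "t \<in> {0..1}" for t
  proof -
    have "norm (u 0 - y) \<le> exp L * norm (u t - y)" if y: "y \<in> S" for y
    proof (rule curve_dist(2)[OF u' _ t])
      fix s :: real assume s: "s \<in> {0..1}"
      have "norm (Y s (u s)) \<le> L * infdist (u s) S"
        using in_ball[OF s] by (intro gr s) auto
      also have "\<dots> \<le> L * norm (u s - y)"
        by (intro mult_left_mono infdist_le_norm y L)
      finally show "norm (Y s (u s)) \<le> L * norm (u s - y)" .
    qed
    then show ?thesis
      unfolding \<epsilon>_def u0[symmetric] by (rule infdist_le_exp_infdist)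
  qed
  have "traj \<rho> X u"
    unfolding traj_def
  proof (intro ballI conjI)
    fix t :: real assume t: "t \<in> {0..1}"
    show "norm (u t) \<le> \<rho>" by (rule in_ball[OF t])
    show "(u has_vector_derivative X t (u t)) (at t within {0..1})"
      using u'[OF t] eq[OF t _ far[OF t]] in_ball[OF t] by simp
  qed
  with u0 show ?thesis by blast
qed

text \<open>The time-one map. It is meaningful on the ball of radius
  \<open>exp (- L) * \<rho>\<close>, where a curve exists; there \<open>traj_unique\<close> makes
  the choice harmless.\<close>

definition flow :: "'a \<Rightarrow> 'a" where
  "flow x = (SOME u. traj \<rho> X u \<and> u 0 = x) 1"

lemma flow_traj:
  assumes "norm x \<le> exp (- L) * \<rho>"
  obtains u where "traj \<rho> X u" "u 0 = x" "u 1 = flow x"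
proof -
  from someI_ex[OF traj_exists[OF assms]] show ?thesis
    using that[of "SOME u. traj \<rho> X u \<and> u 0 = x"] unfolding flow_def by blast
qed

lemma flow_eq: "traj \<rho> X u \<Longrightarrow> u 0 = x \<Longrightarrow> norm x \<le> exp (- L) * \<rho> \<Longrightarrow> flow x = u 1"
  by (metis flow_traj traj_unique)

lemma flow_dist:
  assumes "norm x \<le> exp (- L) * \<rho>" "y \<in> S"
  shows "norm (flow x - y) \<le> exp L * norm (x - y)"
proof -
  obtain u where u: "traj \<rho> X u" "u 0 = x" "u 1 = flow x"
    by (rule flow_traj[OF assms(1)])
  show ?thesis
    using traj_dist(1)[OF u(1) assms(2), of 1] u by simp
qed

lemma flow_fixes: "x \<in> S \<Longrightarrow> norm x \<le> exp (- L) * \<rho> \<Longrightarrow> flow x = x"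
  using flow_dist[of x x] by simp

text \<open>At a point of \<open>S\<close>, which is fixed, continuity is the estimate
  \<open>flow_dist\<close>. At any other point, all starting points in a neighbourhood keep half its
  distance to \<open>S\<close>, and \<open>traj_lipschitz\<close> applies to them uniformly.\<close>

lemma continuous_on_flow: "continuous_on (cball 0 (exp (- L) * \<rho>)) flow"
proof (rule continuous_onI)
  let ?B = "cball (0::'a) (exp (- L) * \<rho>)"
  fix x e assume x: "x \<in> ?B" and e: "e > (0::real)"
  show "\<exists>d>0. \<forall>x'\<in>?B. dist x' x < d \<longrightarrow> dist (flow x') (flow x) \<le> e"
  proof (cases "x \<in> S")
    case True
    show ?thesis
    proof (intro exI[of _ "exp (- L) * e"] conjI ballI impI)
      fix x' assume x': "x' \<in> ?B" "dist x' x < exp (- L) * e"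
      have "norm (flow x' - x) \<le> exp L * norm (x' - x)"
        using x' by (intro flow_dist True) auto
      also have "\<dots> \<le> exp L * (exp (- L) * e)"
        using x' by (intro mult_left_mono) (auto simp: dist_norm)
      finally show "dist (flow x') (flow x) \<le> e"
        using flow_fixes[OF True] x by (simp add: dist_norm exp_mult_exp_minus)
    qed (use e in auto)
  next
    case False
    define \<epsilon> where "\<epsilon> = infdist x S / 2"
    have \<epsilon>: "\<epsilon> > 0" using infdist_pos[OF False] by (simp add: \<epsilon>_def)
    from traj_lipschitz[OF \<epsilon>] obtain M where
      M: "\<And>u v. \<lbrakk>traj \<rho> X u; traj \<rho> X v; \<epsilon> \<le> infdist (u 0) S; \<epsilon> \<le> infdist (v 0) S\<rbrakk> \<Longrightarrow>
        norm (u 1 - v 1) \<le> exp M * norm (u 0 - v 0)"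
      by blast
    show ?thesis
    proof (intro exI[of _ "min \<epsilon> (exp (- M) * e)"] conjI ballI impI)
      fix x' assume x': "x' \<in> ?B" "dist x' x < min \<epsilon> (exp (- M) * e)"
      have "infdist x S \<le> infdist x' S + dist x x'"
        by (rule infdist_triangle)
      with x' have far: "\<epsilon> \<le> infdist x' S" "\<epsilon> \<le> infdist x S"
        using \<epsilon> by (auto simp: \<epsilon>_def dist_commute)
      obtain u where u: "traj \<rho> X u" "u 0 = x" "u 1 = flow x"
        using flow_traj[of x] x by auto
      obtain v where v: "traj \<rho> X v" "v 0 = x'" "v 1 = flow x'"
        using flow_traj[of x'] x' by auto
      have "norm (flow x' - flow x) \<le> exp M * norm (x' - x)"
        using M[OF v(1) u(1)] u v far by simp
      also have "\<dots> \<le> exp M * (exp (- M) * e)"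
        using x' by (intro mult_left_mono) (auto simp: dist_norm)
      finally show "dist (flow x') (flow x) \<le> e"
        by (simp add: dist_norm exp_mult_exp_minus)
    qed (use e \<epsilon> in auto)
  qed
qed

end

lemma (in relative_field) sigma_V_equiv_if_flow_zeros:
  assumes zeros: "\<And>u. traj \<rho> X u \<Longrightarrow> f (u 0) = 0 \<longleftrightarrow> g (u 1) = 0"
  shows "sigma_V_equiv S f g"
proof -
  interpret rev: relative_field S \<rho> L "\<lambda>t x. - X (1 - t) x"
    by (rule reverse)
  \<comment> \<open>Both time-one maps are defined up to radius \<rho>1. The further factor
    \<open>exp (- L)\<close> in \<open>U\<close> keeps the image of \<open>U\<close> where the
    reverse flow is defined. Taking \<open>V\<close> as a preimage of \<open>U\<close> under the
    reverse flow yields openness from continuity alone, in place of invariance of domain.\<close>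
  define \<rho>1 where "\<rho>1 = exp (- L) * \<rho>"
  define U where "U = ball (0::'a) (exp (- L) * \<rho>1)"
  define V where "V = {y \<in> ball 0 \<rho>1. rev.flow y \<in> U}"
  have \<rho>1: "\<rho>1 > 0" using \<rho> by (simp add: \<rho>1_def)
  have U_sub: "norm x < \<rho>1" if "x \<in> U" for x
    using that L \<rho>1 unfolding U_def
    by (smt (verit) mem_ball_0 exp_le_one_iff mult_left_le_one_le exp_ge_zero)
  have V_sub: "norm x < \<rho>1" if "x \<in> V" for x
    using that unfolding V_def by simp
  have openV: "open V"
  proof -
    have "continuous_on (ball 0 \<rho>1) rev.flow"
      by (rule continuous_on_subset[OF rev.continuous_on_flow]) (auto simp: \<rho>1_def)
    from continuous_open_preimage[OF this, of U] show ?thesis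
      unfolding V_def U_def by (simp add: vimage_def Int_def)
  qed
  have flow_U: "flow x \<in> V \<and> rev.flow (flow x) = x \<and> (f x = 0 \<longleftrightarrow> g (flow x) = 0)" if "x \<in> U" for x
  proof -
    have x: "norm x \<le> exp (- L) * \<rho>" using U_sub[OF that] by (simp add: \<rho>1_def)
    obtain u where u: "traj \<rho> X u" "u 0 = x" "u 1 = flow x"
      by (rule flow_traj[OF x])
    have "norm (flow x - 0) \<le> exp L * norm (x - 0)"
      by (rule flow_dist[OF x S(2)])
    also have "\<dots> < exp L * (exp (- L) * \<rho>1)"
      using that by (simp add: U_def)
    finally have n: "norm (flow x) < \<rho>1"
      by (simp add: exp_mult_exp_minus)
    have "rev.flow (flow x) = x"
      using rev.flow_eq[OF traj_reverse[OF u(1)], of "flow x"] u n by (simp add: \<rho>1_def)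
    with n that zeros[OF u(1)] u show ?thesis
      by (auto simp: V_def)
  qed
  have flow_V: "rev.flow y \<in> U \<and> flow (rev.flow y) = y" if "y \<in> V" for y
  proof -
    have y: "norm y \<le> exp (- L) * \<rho>" using V_sub[OF that] by (simp add: \<rho>1_def)
    obtain v where v: "traj \<rho> (\<lambda>t x. - X (1 - t) x) v" "v 0 = y" "v 1 = rev.flow y"
      by (rule rev.flow_traj[OF y])
    have kU: "rev.flow y \<in> U" using that by (simp add: V_def)
    have "traj \<rho> X (\<lambda>t. v (1 - t))"
      using traj_reverse[OF v(1)] by simp
    from flow_eq[OF this, of "rev.flow y"] have "flow (rev.flow y) = y"
      using v U_sub[OF kU] by (simp add: \<rho>1_def)
    with kU show ?thesis by simp
  qed
  have "homeomorphism (f -` {0} \<inter> U) (g -` {0} \<inter> V) flow rev.flow"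
  proof (rule homeomorphismI)
    show "continuous_on (f -` {0} \<inter> U) flow"
      using continuous_on_flow by (rule continuous_on_subset) (use less_imp_le[OF U_sub] in \<open>auto simp: \<rho>1_def\<close>)
    show "continuous_on (g -` {0} \<inter> V) rev.flow"
      using rev.continuous_on_flow by (rule continuous_on_subset) (use less_imp_le[OF V_sub] in \<open>auto simp: \<rho>1_def\<close>)
    show "flow ` (f -` {0} \<inter> U) \<subseteq> g -` {0} \<inter> V"
      using flow_U by auto
    show "rev.flow ` (g -` {0} \<inter> V) \<subseteq> f -` {0} \<inter> U"
    proof (intro image_subsetI)
      fix y assume y: "y \<in> g -` {0} \<inter> V"
      with flow_V[of y] flow_U[of "rev.flow y"] show "rev.flow y \<in> f -` {0} \<inter> U"
        by auto
    qed
  qed (use flow_U flow_V in auto)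
  moreover have "\<forall>x \<in> f -` {0} \<inter> S \<inter> U. flow x = x"
    using flow_fixes less_imp_le[OF U_sub] by (auto simp: \<rho>1_def)
  moreover have "0 \<in> V"
    using rev.flow_fixes[OF S(2)] \<rho>1 \<rho> by (simp add: V_def U_def)
  moreover have "open U" "0 \<in> U"
    using \<rho>1 by (auto simp: U_def)
  ultimately show ?thesis
    unfolding sigma_V_equiv_def using openV by blast
qed

section \<open>The regularised normal equation\<close>

lemma norm_matrix_vector_mult_le:
  fixes A :: "real^'n^'m"
  shows "norm (A *v x) \<le> norm A * norm x"
proof -
  have "norm (A *v x) = L2_set (\<lambda>i. norm ((A *v x) $ i)) UNIV"
    by (simp add: norm_vec_def)
  also have "\<dots> \<le> L2_set (\<lambda>i. norm (A $ i) * norm x) UNIV"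
    by (intro L2_set_mono) (auto simp: matrix_mult_dot Cauchy_Schwarz_ineq2)
  also have "\<dots> = norm A * norm x"
    by (simp add: norm_vec_def L2_set_left_distrib)
  finally show ?thesis .
qed

lemma norm_vector_matrix_mult_le:
  fixes A :: "real^'n^'m"
  shows "norm (x v* A) \<le> norm A * norm x"
proof -
  have "(norm (x v* A))\<^sup>2 = x \<bullet> (A *v (x v* A))"
    by (metis dot_lmul_matrix power2_norm_eq_inner)
  also have "\<dots> \<le> norm x * (norm A * norm (x v* A))"
    by (meson norm_cauchy_schwarz norm_matrix_vector_mult_le mult_left_mono norm_ge_zero order_trans)
  finally have "norm (x v* A) * norm (x v* A) \<le> (norm A * norm x) * norm (x v* A)"
    by (simp add: power2_eq_square algebra_simps)
  then show ?thesis
    by (cases "norm (x v* A) = 0") (auto simp: mult_le_cancel_right)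
qed

text \<open>Throughout, \<open>v v* A\<close> stands for \<open>A\<^sup>T v\<close>. Multiplication
  by \<open>matrix_inv\<close> gives the value 0 for \<open>b = 0\<close> even if the matrix is
  singular, which makes the later vector field vanish on \<Sigma>.\<close>

definition reg_solve :: "real^'n^'p \<Rightarrow> real \<Rightarrow> real^'p \<Rightarrow> real^'p" where
  "reg_solve A c b = matrix_inv (A ** transpose A + mat c) *v b"

lemma reg_matrix_mult:
  fixes A :: "real^'n^'p"
  shows "(A ** transpose A + mat c) *v v = A *v (v v* A) + c *\<^sub>R v"
proof -
  have "mat c *v v = c *\<^sub>R v"
    by (simp add: vec_eq_iff matrix_vector_mult_def mat_def if_distrib[where f = "\<lambda>x. x * _"] cong: if_cong)
  then show ?thesis
    by (simp add: matrix_vector_mult_add_rdistrib matrix_vector_mul_assoc[symmetric])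
qed

lemma reg_energy:
  fixes A :: "real^'n^'p"
  shows "v \<bullet> (A *v (v v* A) + c *\<^sub>R v) = (norm (v v* A))\<^sup>2 + c * (norm v)\<^sup>2"
  by (simp add: inner_add_right dot_lmul_matrix[symmetric] power2_norm_eq_inner)

text \<open>Only a lower bound \<open>m\<close> for the quadratic form of
  \<open>A A\<^sup>T + c\<close> is assumed: in the horn it will come from \<open>A\<close>, off the
  horn from \<open>c\<close>.\<close>

context
  fixes A :: "real^'n^'p" and c m :: real
  assumes m: "m > 0"
    and coercive: "\<And>v. m * (norm v)\<^sup>2 \<le> (norm (v v* A))\<^sup>2 + c * (norm v)\<^sup>2"
begin

lemma reg_bound: "m * norm v \<le> norm (A *v (v v* A) + c *\<^sub>R v)"
proof -
  have "m * (norm v)\<^sup>2 \<le> norm v * norm (A *v (v v* A) + c *\<^sub>R v)"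
    using coercive[of v] norm_cauchy_schwarz[of v "A *v (v v* A) + c *\<^sub>R v"]
    unfolding reg_energy by linarith
  then have "(m * norm v) * norm v \<le> norm (A *v (v v* A) + c *\<^sub>R v) * norm v"
    by (simp add: power2_eq_square algebra_simps)
  then show ?thesis
    by (cases "norm v = 0") (auto simp: mult_le_cancel_right)
qed

lemma reg_solve_eq:
  "A *v (reg_solve A c b v* A) + c *\<^sub>R reg_solve A c b = b"
proof -
  let ?M = "A ** transpose A + mat c"
  have "v = 0" if "?M *v v = 0" for v
  proof -
    have "m * norm v \<le> 0"
      using reg_bound[of v] that unfolding reg_matrix_mult by simp
    then show ?thesis using m by (simp add: mult_le_0_iff)
  qed
  then have "inj ((*v) ?M)"
    by (simp add: linear_injective_0)
  then have "invertible ?M"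
    by (simp add: invertible_left_inverse matrix_left_invertible_injective)
  then have "?M ** matrix_inv ?M = mat 1"
    unfolding invertible_def matrix_inv_def by (rule someI2_ex) simp
  then have "?M *v (matrix_inv ?M *v b) = b"
    by (simp add: matrix_vector_mul_assoc)
  then show ?thesis
    by (simp only: reg_matrix_mult[symmetric] reg_solve_def)
qed

lemma reg_solve_bound: "m * norm (reg_solve A c b) \<le> norm b"
  using reg_bound[of "reg_solve A c b"] unfolding reg_solve_eq .

text \<open>The equation tested with its own solution. Unlike \<open>reg_solve_bound\<close>, the
  estimate is free of \<open>m\<close>, which degenerates near \<Sigma>; the growth bound of the
  field rests on this.\<close>

lemma reg_solve_energy:
  "(norm (reg_solve A c b v* A))\<^sup>2 + c * (norm (reg_solve A c b))\<^sup>2 \<le> norm b * norm (reg_solve A c b)"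
  using norm_cauchy_schwarz[of "reg_solve A c b" b] reg_energy[of "reg_solve A c b" A c]
  unfolding reg_solve_eq by (simp add: mult.commute)

end

lemma reg_field_lipschitz:
  fixes A A' :: "real^'n^'p"
  assumes m: "m > 0"
    and co: "\<And>v. m * (norm v)\<^sup>2 \<le> (norm (v v* A))\<^sup>2 + c * (norm v)\<^sup>2"
    and co': "\<And>v. m * (norm v)\<^sup>2 \<le> (norm (v v* A'))\<^sup>2 + c' * (norm v)\<^sup>2"
    and A: "norm A \<le> a" and A': "norm A' \<le> a" and b': "norm b' \<le> \<beta>"
  shows "norm (reg_solve A c b v* A - reg_solve A' c' b' v* A') \<le>
    (a / m * (1 + 2 * a * (\<beta> / m) + \<beta> / m) + \<beta> / m) *
    (norm (A - A') + \<bar>c - c'\<bar> + norm (b - b'))"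
proof -
  define l l' where "l = reg_solve A c b" and "l' = reg_solve A' c' b'"
  define D where "D = norm (A - A') + \<bar>c - c'\<bar> + norm (b - b')"
  have a: "a \<ge> 0" using A norm_ge_zero order_trans by blast
  have \<beta>: "\<beta> \<ge> 0" using b' norm_ge_zero order_trans by blast
  have D: "norm (A - A') \<le> D" "\<bar>c - c'\<bar> \<le> D" "norm (b - b') \<le> D" "0 \<le> D"
    by (auto simp: D_def)
  have l': "norm l' \<le> \<beta> / m"
    using reg_solve_bound[OF m co', of b'] b' m by (simp add: l'_def field_simps)
  have diff: "norm (v v* A - v v* A') \<le> D * norm v" for v
  proof -
    have "norm (v v* A - v v* A') = norm (v v* (A - A'))"
      by (simp add: vector_matrix_mult_diff_rdistrib)
    also have "\<dots> \<le> norm (A - A') * norm v"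
      by (rule norm_vector_matrix_mult_le)
    also have "\<dots> \<le> D * norm v"
      by (intro mult_right_mono D) auto
    finally show ?thesis .
  qed
  \<comment> \<open>Subtracting the two equations shows that \<open>l - l'\<close> solves the first
    one with a right-hand side made of differences of the data, so \<open>reg_bound\<close> controls
    it.\<close>
  have "A *v ((l - l') v* A) + c *\<^sub>R (l - l') =
      (A *v (l v* A) + c *\<^sub>R l) - (A' *v (l' v* A') + c' *\<^sub>R l')
      - (A *v (l' v* A - l' v* A') + (A - A') *v (l' v* A') + (c - c') *\<^sub>R l')"
    by (simp add: algebra_simps)
  also have "\<dots> = (b - b') - (A *v (l' v* A - l' v* A') + (A - A') *v (l' v* A') + (c - c') *\<^sub>R l')"
    unfolding l_def l'_def reg_solve_eq[OF m co] reg_solve_eq[OF m co'] ..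
  finally have eq: "A *v ((l - l') v* A) + c *\<^sub>R (l - l') = \<dots>" .
  have "norm (A *v (l' v* A - l' v* A')) \<le> a * (D * norm l')"
    by (intro order_trans[OF norm_matrix_vector_mult_le] mult_mono A diff a) auto
  moreover have "norm ((A - A') *v (l' v* A')) \<le> D * (a * norm l')"
    by (intro order_trans[OF norm_matrix_vector_mult_le] mult_mono D
        order_trans[OF norm_vector_matrix_mult_le] A' a) auto
  moreover have "norm ((c - c') *\<^sub>R l') \<le> D * norm l'"
    by (simp add: mult_right_mono D)
  ultimately have "m * norm (l - l') \<le> D + (a * (D * norm l') + D * (a * norm l') + D * norm l')"
    using reg_bound[OF m co, of "l - l'"] D(3) unfolding eq
    by (smt (verit) norm_triangle_ineq norm_triangle_ineq4)
  also have "\<dots> = D * (1 + 2 * a * norm l' + norm l')"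
    by (simp add: algebra_simps)
  also have "\<dots> \<le> D * (1 + 2 * a * (\<beta> / m) + \<beta> / m)"
    by (intro mult_left_mono add_mono l' D) (use a in auto)
  finally have l: "norm (l - l') \<le> D * (1 + 2 * a * (\<beta> / m) + \<beta> / m) / m"
    using m by (simp add: field_simps)
  have "norm (l v* A - l' v* A') = norm ((l - l') v* A + (l' v* A - l' v* A'))"
    by (simp add: algebra_simps)
  also have "\<dots> \<le> norm ((l - l') v* A) + norm (l' v* A - l' v* A')"
    by (rule norm_triangle_ineq)
  also have "\<dots> \<le> a * (D * (1 + 2 * a * (\<beta> / m) + \<beta> / m) / m) + D * (\<beta> / m)"
    by (intro add_mono order_trans[OF norm_vector_matrix_mult_le] mult_mono A l a
        order_trans[OF diff] l' D) auto
  also have "\<dots> = (a / m * (1 + 2 * a * (\<beta> / m) + \<beta> / m) + \<beta> / m) * D"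
    by (simp add: algebra_simps add_divide_distrib)
  finally show ?thesis
    by (simp only: l_def l'_def D_def)
qed

section \<open>Maps of class \<open>C\<^sup>k\<close> and their jets\<close>

lemma Ck_on_cong:
  assumes "open U" "\<And>x. x \<in> U \<Longrightarrow> f x = g x" "Ck_on k f U"
  shows "Ck_on k g U"
  using assms
proof (induction k arbitrary: f g)
  case 0
  then show ?case by (simp cong: continuous_on_cong)
next
  case (Suc k)
  have diff: "f differentiable at x" if "x \<in> U" for x
    using Suc.prems that by (simp add: differentiable_on_eq_differentiable_at)
  have eq: "frechet_derivative f (at x) = frechet_derivative g (at x)" if "x \<in> U" for x
    using frechet_derivative_transform_within_open[OF diff[OF that] Suc.prems(1) that Suc.prems(2)] .
  have "g differentiable at x" if "x \<in> U" for x
    using diff[OF that] Suc.prems(1,2) that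
    unfolding differentiable_def by (metis has_derivative_transform_within_open)
  moreover have "Ck_on k (\<lambda>x. frechet_derivative g (at x) v) U" for v
    by (rule Suc.IH[of "\<lambda>x. frechet_derivative f (at x) v"]) (use Suc.prems eq in auto)
  ultimately show ?case
    using Suc.prems(1) by (simp add: differentiable_on_eq_differentiable_at)
qed

lemma Ck_on_subset: "Ck_on k f U \<Longrightarrow> V \<subseteq> U \<Longrightarrow> Ck_on k f V"
proof (induction k arbitrary: f)
  case 0
  then show ?case by (auto intro: continuous_on_subset)
next
  case (Suc k)
  then show ?case by (auto intro: differentiable_on_subset)
qed

lemma Ck_on_SucD: "Ck_on (Suc k) f U \<Longrightarrow> Ck_on k f U"
proof (induction k arbitrary: f)
  case 0
  then show ?case by (auto intro: differentiable_imp_continuous_on)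
next
  case (Suc k)
  have "Ck_on k (\<lambda>x. frechet_derivative f (at x) v) U" for v
    by (rule Suc.IH) (use Suc.prems in auto)
  then show ?case using Suc.prems by simp
qed

lemma Ck_on_mono: "Ck_on k f U \<Longrightarrow> j \<le> k \<Longrightarrow> Ck_on j f U"
proof (induction k)
  case 0
  then show ?case by simp
next
  case (Suc k)
  show ?case
  proof (cases "j = Suc k")
    case False
    then show ?thesis using Suc.IH[OF Ck_on_SucD[OF Suc.prems(1)]] Suc.prems(2) by simp
  qed (use Suc.prems in simp)
qed

lemma Ck_on_differentiable: "Ck_on (Suc k) f U \<Longrightarrow> open U \<Longrightarrow> x \<in> U \<Longrightarrow> f differentiable at x"
  by (simp add: differentiable_on_eq_differentiable_at)

lemma frechet_derivative_lincomb:
  assumes "f differentiable at x" "g differentiable at x"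
  shows "((\<lambda>x. a *\<^sub>R f x + b *\<^sub>R g x) has_derivative
      (\<lambda>v. a *\<^sub>R frechet_derivative f (at x) v + b *\<^sub>R frechet_derivative g (at x) v)) (at x)"
    and "frechet_derivative (\<lambda>x. a *\<^sub>R f x + b *\<^sub>R g x) (at x) =
      (\<lambda>v. a *\<^sub>R frechet_derivative f (at x) v + b *\<^sub>R frechet_derivative g (at x) v)"
proof -
  show *: "((\<lambda>x. a *\<^sub>R f x + b *\<^sub>R g x) has_derivative
      (\<lambda>v. a *\<^sub>R frechet_derivative f (at x) v + b *\<^sub>R frechet_derivative g (at x) v)) (at x)"
    using assms unfolding frechet_derivative_works by (intro has_derivative_add has_derivative_scaleR_right)
  show "frechet_derivative (\<lambda>x. a *\<^sub>R f x + b *\<^sub>R g x) (at x) =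
      (\<lambda>v. a *\<^sub>R frechet_derivative f (at x) v + b *\<^sub>R frechet_derivative g (at x) v)"
    using frechet_derivative_at[OF *] by simp
qed

lemma Ck_on_lincomb:
  assumes "open U" "Ck_on k f U" "Ck_on k g U"
  shows "Ck_on k (\<lambda>x. a *\<^sub>R f x + b *\<^sub>R g x) U"
  using assms(2,3)
proof (induction k arbitrary: f g)
  case 0
  then show ?case by (auto intro!: continuous_intros)
next
  case (Suc k)
  have diff: "f differentiable at x" "g differentiable at x" if "x \<in> U" for x
    using Suc.prems assms(1) that by (auto intro: Ck_on_differentiable)
  have "Ck_on k (\<lambda>x. a *\<^sub>R frechet_derivative f (at x) v + b *\<^sub>R frechet_derivative g (at x) v) U" for v
    by (rule Suc.IH) (use Suc.prems in auto)
  then have "Ck_on k (\<lambda>x. frechet_derivative (\<lambda>x. a *\<^sub>R f x + b *\<^sub>R g x) (at x) v) U" for v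
    by (rule Ck_on_cong[OF assms(1), rotated]) (simp add: frechet_derivative_lincomb(2) diff)
  moreover have "(\<lambda>x. a *\<^sub>R f x + b *\<^sub>R g x) differentiable at x" if "x \<in> U" for x
    using frechet_derivative_lincomb(1)[OF diff[OF that]] differentiable_def by blast
  ultimately show ?case
    using assms(1) by (simp add: differentiable_on_eq_differentiable_at)
qed

text \<open>In \<open>dderiv\<close> the last direction of the list is differentiated first.
  Induction from the end of the list thus matches the recursion of \<open>Ck_on\<close>, which
  differentiates the map itself.\<close>

lemma dderiv_snoc: "dderiv f (vs @ [v]) = dderiv (\<lambda>x. frechet_derivative f (at x) v) vs"
  by (induction vs) simp_all

lemma Ck_on_dderiv: "Ck_on (length vs + k) f U \<Longrightarrow> Ck_on k (dderiv f vs) U"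
proof (induction vs arbitrary: f rule: rev_induct)
  case Nil
  then show ?case by simp
next
  case (snoc v vs)
  show ?case
    unfolding dderiv_snoc by (rule snoc.IH) (use snoc.prems in auto)
qed

lemma dderiv_lincomb:
  assumes "open U" "Ck_on k f U" "Ck_on k g U" "length vs \<le> k" "x \<in> U"
  shows "dderiv (\<lambda>x. a *\<^sub>R f x + b *\<^sub>R g x) vs x = a *\<^sub>R dderiv f vs x + b *\<^sub>R dderiv g vs x"
  using assms(4,5)
proof (induction vs arbitrary: x)
  case Nil
  then show ?case by simp
next
  case (Cons v vs)
  have "Ck_on (Suc 0) (dderiv h vs) U" if "Ck_on k h U" for h :: "'a \<Rightarrow> 'b"
    by (rule Ck_on_dderiv, rule Ck_on_mono[OF that]) (use Cons.prems in simp)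
  then have diff: "dderiv f vs differentiable at y" "dderiv g vs differentiable at y" if "y \<in> U" for y
    using assms that Ck_on_differentiable by blast+
  let ?h = "\<lambda>y. a *\<^sub>R dderiv f vs y + b *\<^sub>R dderiv g vs y"
  have "?h differentiable at x"
    using frechet_derivative_lincomb(1)[OF diff[OF Cons.prems(2)]] differentiable_def by blast
  then have "frechet_derivative (dderiv (\<lambda>x. a *\<^sub>R f x + b *\<^sub>R g x) vs) (at x) = frechet_derivative ?h (at x)"
    by (rule frechet_derivative_transform_within_open[OF _ assms(1) Cons.prems(2), symmetric])
      (use Cons in simp)
  then show ?case
    using frechet_derivative_lincomb(2)[OF diff[OF Cons.prems(2)]] by simp
qed

section \<open>Lipschitz and Taylor estimates on compact convex sets\<close>

lemma Ck_on_lipschitz: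
  fixes f :: "'a::euclidean_space \<Rightarrow> 'b::real_normed_vector"
  assumes "open U" "Ck_on (Suc 0) f U" "compact C" "convex C" "C \<subseteq> U"
  shows "\<exists>K\<ge>0. \<forall>x\<in>C. \<forall>y\<in>C. norm (f x - f y) \<le> K * norm (x - y)"
proof -
  let ?D = "\<lambda>x. frechet_derivative f (at x)"
  have der: "(f has_derivative ?D x) (at x)" if "x \<in> C" for x
    using Ck_on_differentiable[OF assms(2,1)] that assms(5) frechet_derivative_works by blast
  \<comment> \<open>Continuity is available for each directional derivative separately, so the
    operator norm is controlled by the sum over a basis.\<close>
  have "continuous_on C (\<lambda>x. \<Sum>b\<in>Basis. norm (?D x b))"
    using assms by (intro continuous_intros) (auto intro: continuous_on_subset)
  then have "bounded ((\<lambda>x. \<Sum>b\<in>Basis. norm (?D x b)) ` C)"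
    using assms(3) by (intro compact_imp_bounded compact_continuous_image)
  then obtain K where K: "\<And>x. x \<in> C \<Longrightarrow> \<bar>\<Sum>b\<in>Basis. norm (?D x b)\<bar> \<le> K" "K > 0"
    unfolding bounded_pos by auto
  have "norm (f x - f y) \<le> K * norm (x - y)" if "x \<in> C" "y \<in> C" for x y
  proof (rule differentiable_bound[OF assms(4) _ _ that])
    fix z assume z: "z \<in> C"
    show "(f has_derivative ?D z) (at z within C)"
      using der[OF z] by (rule has_derivative_at_withinI)
    have "onorm (?D z) \<le> (\<Sum>b\<in>Basis. norm (?D z b))"
      using der[OF z] has_derivative_bounded_linear by (intro onorm_componentwise)
    then show "onorm (?D z) \<le> K"
      using K(1)[OF z] by linarith
  qed
  then show ?thesis using K(2) by (intro exI[of _ K]) auto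
qed

text \<open>Taylor's estimate by induction: the first derivatives of \<open>f - g\<close> are flat
  of order \<open>k\<close>, and the mean value inequality on the segment from \<open>y\<close> to
  \<open>x\<close> gains one power. Equality of jets up to order \<open>k - 1\<close> gives order
  \<open>k\<close>, hence r-jets give the exponent \<open>r + 1\<close>. The constant is uniform in
  \<open>y\<close>, which later allows a nearest point of \<Sigma> to be inserted.\<close>

lemma jet_eq_imp_flat:
  fixes f g :: "'a::euclidean_space \<Rightarrow> 'b::real_normed_vector"
  assumes "open U" "Ck_on k f U" "Ck_on k g U" "compact C" "convex C" "C \<subseteq> U"
    and "\<And>y vs. y \<in> S \<inter> C \<Longrightarrow> length vs < k \<Longrightarrow> dderiv f vs y = dderiv g vs y"
  shows "\<exists>K\<ge>0. \<forall>x\<in>C. \<forall>y\<in>S \<inter> C. norm (f x - g x) \<le> K * norm (x - y) ^ k"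
  using assms(2,3,7)
proof (induction k arbitrary: f g)
  case 0
  then have "continuous_on C (\<lambda>x. norm (f x - g x))"
    using assms(6) by (intro continuous_intros) (auto intro: continuous_on_subset)
  then have "bounded ((\<lambda>x. norm (f x - g x)) ` C)"
    using assms(4) by (intro compact_imp_bounded compact_continuous_image)
  then obtain K where K: "\<And>x. x \<in> C \<Longrightarrow> norm (f x - g x) \<le> K" "K > 0"
    unfolding bounded_pos by auto
  then show ?case by (intro exI[of _ K]) auto
next
  case (Suc k)
  let ?D = "\<lambda>f x. frechet_derivative f (at x)"
  have "\<exists>K\<ge>0. \<forall>x\<in>C. \<forall>y\<in>S \<inter> C. norm (?D f x b - ?D g x b) \<le> K * norm (x - y) ^ k" for b
  proof (rule Suc.IH)
    show "Ck_on k (\<lambda>x. ?D f x b) U" "Ck_on k (\<lambda>x. ?D g x b) U"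
      using Suc.prems by auto
    show "dderiv (\<lambda>x. ?D f x b) vs y = dderiv (\<lambda>x. ?D g x b) vs y" if "y \<in> S \<inter> C" "length vs < k" for y vs
      using Suc.prems(3)[of y "vs @ [b]"] that by (simp add: dderiv_snoc)
  qed
  then obtain K where K: "\<And>b. K b \<ge> 0"
    "\<And>b x y. \<lbrakk>x \<in> C; y \<in> S \<inter> C\<rbrakk> \<Longrightarrow> norm (?D f x b - ?D g x b) \<le> K b * norm (x - y) ^ k"
    by metis
  define K' where "K' = (\<Sum>b\<in>Basis. K b)"
  have "norm (f x - g x) \<le> K' * norm (x - y) ^ Suc k" if x: "x \<in> C" and y: "y \<in> S \<inter> C" for x y
  proof -
    have seg: "closed_segment y x \<subseteq> C"
      using x y assms(5) by (simp add: closed_segment_subset)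
    have "norm ((f x - g x) - (f y - g y)) \<le> (K' * norm (x - y) ^ k) * norm (x - y)"
    proof (rule differentiable_bound[of "closed_segment y x" "\<lambda>x. f x - g x" "\<lambda>x v. ?D f x v - ?D g x v"])
      fix z assume z: "z \<in> closed_segment y x"
      then have zC: "z \<in> C" using seg by auto
      have diff: "(f has_derivative ?D f z) (at z)" "(g has_derivative ?D g z) (at z)"
        using Suc.prems(1,2) zC assms(1,6) Ck_on_differentiable frechet_derivative_works by blast+
      have der: "((\<lambda>x. f x - g x) has_derivative (\<lambda>v. ?D f z v - ?D g z v)) (at z)"
        by (intro has_derivative_diff diff)
      then show "((\<lambda>x. f x - g x) has_derivative (\<lambda>v. ?D f z v - ?D g z v)) (at z within closed_segment y x)"
        by (rule has_derivative_at_withinI)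
      have zy: "norm (z - y) \<le> norm (x - y)"
        using segment_bound1[OF z] by simp
      have "onorm (\<lambda>v. ?D f z v - ?D g z v) \<le> (\<Sum>b\<in>Basis. norm (?D f z b - ?D g z b))"
        using has_derivative_bounded_linear[OF der] by (rule onorm_componentwise)
      also have "\<dots> \<le> (\<Sum>b\<in>Basis. K b * norm (x - y) ^ k)"
        by (intro sum_mono order_trans[OF K(2)[OF zC y]] mult_left_mono power_mono zy K(1)) auto
      finally show "onorm (\<lambda>v. ?D f z v - ?D g z v) \<le> K' * norm (x - y) ^ k"
        by (simp add: K'_def sum_distrib_right)
    qed auto
    moreover have "f y = g y"
      using Suc.prems(3)[OF y, of "[]"] by simp
    ultimately show ?thesis by (simp add: algebra_simps)
  qed
  moreover have "K' \<ge> 0" unfolding K'_def by (intro sum_nonneg K(1))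
  ultimately show ?case by blast
qed

section \<open>Jacobian matrices, with the gradients as rows, and the Kuo quantity\<close>

definition jac :: "(real^'n \<Rightarrow> real^'p) \<Rightarrow> real^'n \<Rightarrow> real^'n^'p" where
  "jac g x = (\<chi> i. grad_comp g i x)"

lemma jac_nth: "jac g x $ i $ k = frechet_derivative g (at x) (axis k 1) $ i"
  by (simp add: jac_def grad_comp_def)

lemma jac_mult:
  assumes "g differentiable at x"
  shows "jac g x *v v = frechet_derivative g (at x) v"
proof -
  have "jac g x = matrix (frechet_derivative g (at x))"
    by (simp add: vec_eq_iff jac_nth matrix_def)
  then show ?thesis
    using linear_frechet_derivative[OF assms] by (simp add: matrix_works linear_matrix_vector_mul_eq)
qed

lemma norm_jac_diff_le:
  fixes g h :: "real^'n \<Rightarrow> real^'p"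
  shows "norm (jac g x - jac h y) \<le>
    (\<Sum>i\<in>(UNIV::'p set). \<Sum>k\<in>UNIV. norm (frechet_derivative g (at x) (axis k 1) - frechet_derivative h (at y) (axis k 1)))"
proof -
  have "norm (jac g x - jac h y) \<le> (\<Sum>i\<in>UNIV. norm ((jac g x - jac h y) $ i))"
    unfolding norm_vec_def by (rule L2_set_le_sum) simp
  also have "\<dots> \<le> (\<Sum>i\<in>(UNIV::'p set). \<Sum>k\<in>UNIV. norm (frechet_derivative g (at x) (axis k 1) - frechet_derivative h (at y) (axis k 1)))"
  proof (rule sum_mono)
    fix i :: 'p
    have "norm ((jac g x - jac h y) $ i) \<le> (\<Sum>k\<in>UNIV. \<bar>(jac g x - jac h y) $ i $ k\<bar>)"
      by (rule norm_le_l1_cart)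
    also have "\<dots> \<le> (\<Sum>k\<in>UNIV. norm (frechet_derivative g (at x) (axis k 1) - frechet_derivative h (at y) (axis k 1)))"
      by (intro sum_mono) (simp add: jac_nth, metis component_le_norm_cart vector_minus_component)
    finally show "norm ((jac g x - jac h y) $ i) \<le> \<dots>" .
  qed
  finally show ?thesis .
qed

text \<open>Let \<open>v $ i\<close> be the entry of largest modulus. Dividing the combination of
  gradients with coefficients \<open>v\<close> by \<open>v $ i\<close> gives the i-th gradient minus
  an element of the span of the others, so its norm is at least \<open>kappa f x\<close>. The factor
  \<open>CARD('p)\<close> compares the norm of \<open>v\<close> with its largest entry.\<close>

lemma kappa_le_norm:
  fixes f :: "real^'n \<Rightarrow> real^'p"
  shows "kappa f x * norm v \<le> real CARD('p) * norm (v v* jac f x)"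
proof (cases "v = 0")
  case True
  then show ?thesis by simp
next
  case False
  let ?g = "\<lambda>i. grad_comp f i x"
  have fin: "finite (range (\<lambda>i. \<bar>v $ i\<bar>))" by simp
  have "Max (range (\<lambda>i. \<bar>v $ i\<bar>)) \<in> range (\<lambda>i. \<bar>v $ i\<bar>)"
    by (rule Max_in[OF fin]) simp
  then obtain i where i: "Max (range (\<lambda>i. \<bar>v $ i\<bar>)) = \<bar>v $ i\<bar>"
    by (rule imageE)
  have max: "\<bar>v $ j\<bar> \<le> \<bar>v $ i\<bar>" for j
    using Max_ge[OF fin, of "\<bar>v $ j\<bar>"] i by simp
  have nv: "norm v \<le> real CARD('p) * \<bar>v $ i\<bar>"
  proof -
    have "norm v \<le> (\<Sum>j\<in>UNIV. \<bar>v $ j\<bar>)" by (rule norm_le_l1_cart)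
    also have "\<dots> \<le> (\<Sum>j\<in>(UNIV::'p set). \<bar>v $ i\<bar>)" by (intro sum_mono max)
    finally show ?thesis by simp
  qed
  then have vi: "v $ i \<noteq> 0" using False by auto
  have vJ: "v v* jac f x = (\<Sum>j\<in>UNIV. v $ j *\<^sub>R ?g j)"
    by (simp add: vec_eq_iff vector_matrix_mult_def jac_def mult.commute)
  let ?s = "- (\<Sum>j\<in>UNIV - {i}. (v $ j / v $ i) *\<^sub>R ?g j)"
  have "kappa f x \<le> infdist (?g i) (span {?g j | j. j \<noteq> i})"
    unfolding kappa_def by (rule Min_le) auto
  also have "\<dots> \<le> dist (?g i) ?s"
    by (intro infdist_le span_neg span_sum span_scale span_base) auto
  also have "\<dots> = norm ((1 / v $ i) *\<^sub>R (\<Sum>j\<in>UNIV. v $ j *\<^sub>R ?g j))"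
    using vi by (simp add: dist_norm sum.remove[of UNIV i] scaleR_right_distrib scaleR_sum_right)
  also have "\<dots> = norm (v v* jac f x) / \<bar>v $ i\<bar>"
    by (simp add: vJ)
  finally have k: "kappa f x * \<bar>v $ i\<bar> \<le> norm (v v* jac f x)"
    using vi by (simp add: field_simps)
  have "kappa f x \<ge> 0"
    unfolding kappa_def by (subst Min_ge_iff) (auto simp: infdist_nonneg)
  then have "kappa f x * norm v \<le> kappa f x * (real CARD('p) * \<bar>v $ i\<bar>)"
    by (intro mult_left_mono nv)
  also have "\<dots> \<le> real CARD('p) * norm (v v* jac f x)"
    using mult_left_mono[OF k, of "real CARD('p)"] by (simp add: algebra_simps)
  finally show ?thesis .
qed

section \<open>The vector field along the homotopy\<close>

text \<open>The time increment multiplies only \<open>b2 - b1\<close>. For the values of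
  \<open>g1\<close> and \<open>g2\<close> this difference has the order of the horn.\<close>

lemma norm_convex_comb_diff_le:
  fixes a1 a2 b1 b2 :: "'a::real_normed_vector"
  assumes "t \<in> {0..1}" "norm (a1 - b1) \<le> E" "norm (a2 - b2) \<le> E" "norm (b2 - b1) \<le> B"
  shows "norm (((1 - t) *\<^sub>R a1 + t *\<^sub>R a2) - ((1 - s) *\<^sub>R b1 + s *\<^sub>R b2)) \<le> E + \<bar>t - s\<bar> * B"
proof -
  have "((1 - t) *\<^sub>R a1 + t *\<^sub>R a2) - ((1 - s) *\<^sub>R b1 + s *\<^sub>R b2) =
      ((1 - t) *\<^sub>R (a1 - b1) + t *\<^sub>R (a2 - b2)) + (t - s) *\<^sub>R (b2 - b1)"
    by (simp add: algebra_simps)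
  also have "norm \<dots> \<le> ((1 - t) * E + t * E) + \<bar>t - s\<bar> * B"
    using assms
    by (intro norm_triangle_le add_mono) (auto intro!: mult_left_mono)
  finally show ?thesis by (simp add: algebra_simps)
qed

text \<open>One ball and one constant \<open>K\<close> serve all estimates. Radius at most 1 makes
  powers of the distance decrease with the exponent, and \<open>w \<le> 1\<close> gives
  \<open>K \<le> K / w\<close>. The Kuo condition enters as a lower bound for the transposed
  Jacobian of the homotopy, normalised to constant 1.\<close>

locale kuo_homotopy =
  fixes \<Sigma> :: "(real^'n) set" and g1 g2 :: "real^'n \<Rightarrow> real^'p" and r :: nat and \<rho> K w :: real
  assumes \<Sigma>: "closed \<Sigma>" "0 \<in> \<Sigma>"
    and r: "r \<ge> 1"
    and \<rho>: "0 < \<rho>" "\<rho> \<le> 1"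
    and w: "0 < w" "w \<le> 1"
    and K: "0 \<le> K"
    and diff1: "\<And>x. x \<in> cball 0 \<rho> \<Longrightarrow> g1 differentiable at x"
    and diff2: "\<And>x. x \<in> cball 0 \<rho> \<Longrightarrow> g2 differentiable at x"
    and flat: "\<And>x. x \<in> cball 0 \<rho> \<Longrightarrow> norm (g2 x - g1 x) \<le> K * infdist x \<Sigma> ^ Suc r"
    and lip1: "\<And>x y. \<lbrakk>x \<in> cball 0 \<rho>; y \<in> cball 0 \<rho>\<rbrakk> \<Longrightarrow> norm (g1 x - g1 y) \<le> K * norm (x - y)"
    and lip2: "\<And>x y. \<lbrakk>x \<in> cball 0 \<rho>; y \<in> cball 0 \<rho>\<rbrakk> \<Longrightarrow> norm (g2 x - g2 y) \<le> K * norm (x - y)"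
    and lipJ1: "\<And>x y. \<lbrakk>x \<in> cball 0 \<rho>; y \<in> cball 0 \<rho>\<rbrakk> \<Longrightarrow> norm (jac g1 x - jac g1 y) \<le> K * norm (x - y)"
    and lipJ2: "\<And>x y. \<lbrakk>x \<in> cball 0 \<rho>; y \<in> cball 0 \<rho>\<rbrakk> \<Longrightarrow> norm (jac g2 x - jac g2 y) \<le> K * norm (x - y)"
    and J1: "\<And>x. x \<in> cball 0 \<rho> \<Longrightarrow> norm (jac g1 x) \<le> K"
    and J2: "\<And>x. x \<in> cball 0 \<rho> \<Longrightarrow> norm (jac g2 x) \<le> K"
    and kuo: "\<And>t x v. \<lbrakk>t \<in> {0..1}; x \<in> cball 0 \<rho>;
        norm ((1 - t) *\<^sub>R g1 x + t *\<^sub>R g2 x) \<le> w * infdist x \<Sigma> ^ Suc r\<rbrakk> \<Longrightarrow>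
        infdist x \<Sigma> ^ r * norm v \<le> norm (v v* ((1 - t) *\<^sub>R jac g1 x + t *\<^sub>R jac g2 x))"
begin

definition F :: "real \<Rightarrow> real^'n \<Rightarrow> real^'p" where
  "F t x = (1 - t) *\<^sub>R g1 x + t *\<^sub>R g2 x"

definition A :: "real \<Rightarrow> real^'n \<Rightarrow> real^'n^'p" where
  "A t x = (1 - t) *\<^sub>R jac g1 x + t *\<^sub>R jac g2 x"

definition P :: "real^'n \<Rightarrow> real^'p" where
  "P x = g2 x - g1 x"

text \<open>The first summand makes the normal equation solvable off the horn without affecting the zeros of
  \<^term>\<open>F t\<close>; the second one makes it uniformly solvable near \<^term>\<open>\<Sigma>\<close> and vanishes at distance at least \<^term>\<open>\<epsilon>\<close>.\<close>
definition reg :: "real \<Rightarrow> real \<Rightarrow> real^'n \<Rightarrow> real" where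
  "reg \<epsilon> t x = norm (F t x) + max 0 (\<epsilon> - infdist x \<Sigma>)"

definition sol :: "real \<Rightarrow> real \<Rightarrow> real^'n \<Rightarrow> real^'p" where
  "sol \<epsilon> t x = reg_solve (A t x) (reg \<epsilon> t x) (P x)"

text \<open>\<open>Y 0\<close> is the field \<open>X\<close> of the overview; for positive
  \<epsilon>, \<open>Y \<epsilon>\<close> is the Lipschitz approximation demanded by
  \<open>relative_field\<close>.\<close>

definition Y :: "real \<Rightarrow> real \<Rightarrow> real^'n \<Rightarrow> real^'n" where
  "Y \<epsilon> t x = - (sol \<epsilon> t x v* A t x)"

lemma infdist_le_1: "x \<in> cball 0 \<rho> \<Longrightarrow> infdist x \<Sigma> \<le> 1"
  using infdist_le[OF \<Sigma>(2), of x] \<rho> by auto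

lemma norm_P_le: "x \<in> cball 0 \<rho> \<Longrightarrow> norm (P x) \<le> K"
  using flat[of x] mult_left_mono[OF power_le_one[OF infdist_nonneg infdist_le_1] K, of x "Suc r"]
  by (simp add: P_def)

lemma norm_A_le:
  assumes "t \<in> {0..1}" "x \<in> cball 0 \<rho>"
  shows "norm (A t x) \<le> K"
proof -
  have "norm (A t x) \<le> (1 - t) * K + t * K"
    unfolding A_def using assms J1[OF assms(2)] J2[OF assms(2)]
    by (intro norm_triangle_le add_mono) (auto intro!: mult_left_mono)
  then show ?thesis by (simp add: algebra_simps)
qed

text \<open>The three entries of \<open>m\<close> match three regions: close to \<Sigma> the cut-off
  term is at least \<open>e\<close>; farther away but off the horn \<open>norm (F t x)\<close>
  exceeds \<open>w * e ^ Suc r\<close>; in the horn the Kuo estimate bounds the quadratic form of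
  \<open>A A\<^sup>T\<close> from below by \<open>(e ^ r)\<^sup>2\<close>.\<close>

lemma coercive:
  assumes t: "t \<in> {0..1}" and x: "x \<in> cball 0 \<rho>" and e: "0 < e" "e \<le> 1"
    and m: "m = min e (min ((e ^ r)\<^sup>2) (w * e ^ Suc r))"
    and far: "e \<le> infdist x \<Sigma> \<or> e \<le> \<epsilon> - infdist x \<Sigma>"
  shows "m * (norm v)\<^sup>2 \<le> (norm (v v* A t x))\<^sup>2 + reg \<epsilon> t x * (norm v)\<^sup>2"
proof -
  have reg: "0 \<le> reg \<epsilon> t x" "norm (F t x) \<le> reg \<epsilon> t x" "\<epsilon> - infdist x \<Sigma> \<le> reg \<epsilon> t x"
    by (auto simp: reg_def add_increasing)
  have *: ?thesis if "m \<le> reg \<epsilon> t x"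
    using mult_right_mono[OF that, of "(norm v)\<^sup>2"] by (simp add: add_increasing)
  show ?thesis
  proof (cases "e \<le> infdist x \<Sigma>")
    case False
    then show ?thesis using far reg m by (intro *) auto
  next
    case True
    show ?thesis
    proof (cases "norm (F t x) \<le> w * infdist x \<Sigma> ^ Suc r")
      case False
      have "w * e ^ Suc r \<le> w * infdist x \<Sigma> ^ Suc r"
        using True e w by (intro mult_left_mono power_mono) auto
      then show ?thesis using False reg m by (intro *) auto
    next
      case horn: True
      have "e ^ r * norm v \<le> infdist x \<Sigma> ^ r * norm v"
        using True e by (intro mult_right_mono power_mono) auto
      also have "\<dots> \<le> norm (v v* A t x)"
        using kuo[OF t x, of v] horn by (simp add: F_def A_def)
      finally have "(e ^ r * norm v)\<^sup>2 \<le> (norm (v v* A t x))\<^sup>2"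
        using e by (intro power_mono) auto
      moreover have "m * (norm v)\<^sup>2 \<le> (e ^ r)\<^sup>2 * (norm v)\<^sup>2"
        using m by (intro mult_right_mono) auto
      moreover have "0 \<le> reg \<epsilon> t x * (norm v)\<^sup>2" using reg by simp
      ultimately show ?thesis by (simp add: power_mult_distrib)
    qed
  qed
qed

lemma coercive_const_pos:
  assumes "0 < e" "m = min e (min ((e ^ r)\<^sup>2) (w * e ^ Suc r))"
  shows "m > 0"
  using assms w by simp

text \<open>Let \<open>q\<close> be the norm of the field and \<open>d\<close> the distance. The
  energy inequality gives \<open>q\<^sup>2 + reg |l|\<^sup>2 \<le> K d^(r+1) |l|\<close>. In the
  horn \<open>d^r |l| \<le> q\<close>, hence \<open>q \<le> K d\<close>. Off the horn
  \<open>reg\<close> exceeds \<open>w d^(r+1)\<close>, hence \<open>|l| \<le> K / w\<close>, and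
  \<open>q\<^sup>2\<close> is at most \<open>(K / w)\<^sup>2 d^(r+1)\<close>. The bound does not
  depend on \<epsilon>, so the approximations share it.\<close>

lemma Y_growth:
  assumes t: "t \<in> {0..1}" and x: "x \<in> cball 0 \<rho>"
  shows "norm (Y \<epsilon> t x) \<le> K / w * infdist x \<Sigma>"
proof (cases "infdist x \<Sigma> = 0")
  case True
  \<comment> \<open>The matrix may be singular here, but a zero right-hand side gives the zero
    field.\<close>
  then have "P x = 0"
    using flat[OF x] by (simp add: P_def)
  then show ?thesis
    using True by (simp add: Y_def sol_def reg_solve_def)
next
  case False
  define d where "d = infdist x \<Sigma>"
  have d: "0 < d" "d \<le> 1"
    using False infdist_nonneg[of x \<Sigma>] infdist_le_1[OF x] by (auto simp: d_def)
  define m where "m = min d (min ((d ^ r)\<^sup>2) (w * d ^ Suc r))"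
  have m: "m > 0"
    using coercive_const_pos[OF d(1) m_def] .
  have co: "m * (norm v)\<^sup>2 \<le> (norm (v v* A t x))\<^sup>2 + reg \<epsilon> t x * (norm v)\<^sup>2" for v
    by (rule coercive[OF t x d m_def]) (simp add: d_def)
  define l q where "l = sol \<epsilon> t x" and "q = norm (sol \<epsilon> t x v* A t x)"
  have q0: "q \<ge> 0" by (simp add: q_def)
  have KwK: "K \<le> K / w"
    using w K by (simp add: pos_le_divide_eq mult_left_le)
  have "q\<^sup>2 + reg \<epsilon> t x * (norm l)\<^sup>2 \<le> norm (P x) * norm l"
    unfolding q_def l_def sol_def by (rule reg_solve_energy[OF m co])
  also have "\<dots> \<le> K * d ^ Suc r * norm l"
    using flat[OF x] by (intro mult_right_mono) (auto simp: P_def d_def)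
  finally have energy: "q\<^sup>2 + reg \<epsilon> t x * (norm l)\<^sup>2 \<le> K * d ^ Suc r * norm l" .
  have reg: "norm (F t x) \<le> reg \<epsilon> t x" "0 \<le> reg \<epsilon> t x"
    by (auto simp: reg_def add_increasing)
  have "q \<le> K / w * d"
  proof (cases "norm (F t x) \<le> w * d ^ Suc r")
    case True
    then have "d ^ r * norm l \<le> q"
      using kuo[OF t x, of l] by (simp add: F_def A_def d_def q_def l_def)
    then have "K * d * (d ^ r * norm l) \<le> K * d * q"
      using K d by (intro mult_left_mono) auto
    moreover have "0 \<le> reg \<epsilon> t x * (norm l)\<^sup>2" using reg by simp
    ultimately have "q * q \<le> (K * d) * q"
      using energy by (simp add: power2_eq_square algebra_simps)
    then have "q \<le> K * d"
      using q0 K d by (cases "q = 0") (auto simp: mult_le_cancel_right)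
    also have "\<dots> \<le> K / w * d"
      using KwK d by (intro mult_right_mono) auto
    finally show ?thesis .
  next
    case False
    have "(w * d ^ Suc r) * (norm l)\<^sup>2 \<le> reg \<epsilon> t x * (norm l)\<^sup>2"
      using False reg by (intro mult_right_mono) auto
    then have "(w * d ^ Suc r) * (norm l)\<^sup>2 \<le> K * d ^ Suc r * norm l"
      using energy by (smt (verit) zero_le_power2)
    then have "(d ^ Suc r * norm l) * (w * norm l) \<le> (d ^ Suc r * norm l) * K"
      by (simp add: power2_eq_square algebra_simps)
    then have l: "norm l \<le> K / w"
      using d w K by (cases "l = 0") (auto simp: mult_le_cancel_left field_simps)
    have "0 \<le> reg \<epsilon> t x * (norm l)\<^sup>2" using reg by simp
    then have "q\<^sup>2 \<le> K * d ^ Suc r * norm l" using energy by linarith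
    \<comment> \<open>\<open>r \<ge> 1\<close> and \<open>d \<le> 1\<close> turn
      \<open>d ^ Suc r\<close> into at most \<open>d\<^sup>2\<close>.\<close>
    also have "\<dots> \<le> K / w * d\<^sup>2 * (K / w)"
      using K KwK d r w by (intro mult_mono l power_decreasing) auto
    also have "\<dots> = (K / w * d)\<^sup>2"
      by (simp add: power2_eq_square)
    finally show ?thesis
      by (rule power2_le_imp_le) (use K w d in simp)
  qed
  then show ?thesis
    by (simp add: Y_def q_def d_def)
qed

lemma Y_lipschitz:
  assumes "\<epsilon> > 0"
  shows "\<exists>M. \<forall>t\<in>{0..1}. \<forall>s\<in>{0..1}. \<forall>x\<in>cball 0 \<rho>. \<forall>y\<in>cball 0 \<rho>.
    norm (Y \<epsilon> t x - Y \<epsilon> s y) \<le> M * (\<bar>t - s\<bar> + norm (x - y))"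
proof -
  \<comment> \<open>Every point is either at distance at least \<open>\<epsilon> / 2\<close> from
    \<Sigma> or has a cut-off term of at least \<open>\<epsilon> / 2\<close>, so one
    \<open>m\<close> serves the whole ball.\<close>
  define e where "e = min 1 (\<epsilon> / 2)"
  have e: "0 < e" "e \<le> 1" using assms by (auto simp: e_def)
  define m where "m = min e (min ((e ^ r)\<^sup>2) (w * e ^ Suc r))"
  have m: "m > 0"
    using coercive_const_pos[OF e(1) m_def] .
  have co: "m * (norm v)\<^sup>2 \<le> (norm (v v* A t x))\<^sup>2 + reg \<epsilon> t x * (norm v)\<^sup>2"
    if "t \<in> {0..1}" "x \<in> cball 0 \<rho>" for t x v
    by (rule coercive[OF that e m_def]) (auto simp: e_def min_def)
  define Q where "Q = K / m * (1 + 2 * K * (K / m) + K / m) + K / m"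
  have Q: "Q \<ge> 0" using K m by (simp add: Q_def)
  \<comment> \<open>The factor adds the Lipschitz constants \<open>2 * K\<close> of
    \<open>A\<close>, \<open>2 * K + 1\<close> of \<open>reg \<epsilon>\<close> and
    \<open>2 * K\<close> of \<open>P\<close>.\<close>
  have "norm (Y \<epsilon> t x - Y \<epsilon> s y) \<le> Q * (6 * K + 1) * (\<bar>t - s\<bar> + norm (x - y))"
    if t: "t \<in> {0..1}" and s: "s \<in> {0..1}" and x: "x \<in> cball 0 \<rho>" and y: "y \<in> cball 0 \<rho>" for t s x y
  proof -
    define D where "D = \<bar>t - s\<bar> + norm (x - y)"
    have D: "\<bar>t - s\<bar> \<le> D" "norm (x - y) \<le> D" "\<bar>t - s\<bar> + norm (x - y) = D"
      by (auto simp: D_def)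
    have KD: "K * \<bar>t - s\<bar> + K * norm (x - y) = K * D"
      by (simp add: D_def algebra_simps)
    have Kts: "0 \<le> K * \<bar>t - s\<bar>" "0 \<le> K * norm (x - y)" using K by auto
    have "norm (A t x - A s y) \<le> K * norm (x - y) + \<bar>t - s\<bar> * (2 * K)"
      unfolding A_def
    proof (rule norm_convex_comb_diff_le[OF t lipJ1[OF x y] lipJ2[OF x y]])
      show "norm (jac g2 y - jac g1 y) \<le> 2 * K"
        using norm_triangle_ineq4[of "jac g2 y" "jac g1 y"] J1[OF y] J2[OF y] by linarith
    qed
    then have 1: "norm (A t x - A s y) \<le> 2 * (K * D)"
      using KD Kts by (simp add: algebra_simps)
    have "norm (F t x - F s y) \<le> K * norm (x - y) + \<bar>t - s\<bar> * K"
      unfolding F_def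
      by (rule norm_convex_comb_diff_le[OF t lip1[OF x y] lip2[OF x y]])
        (use norm_P_le[OF y] in \<open>simp add: P_def\<close>)
    moreover have "\<bar>infdist x \<Sigma> - infdist y \<Sigma>\<bar> \<le> norm (x - y)"
      using infdist_triangle_abs[of x \<Sigma> y] by (simp add: dist_norm)
    moreover have "\<bar>reg \<epsilon> t x - reg \<epsilon> s y\<bar> \<le> norm (F t x - F s y) + \<bar>infdist x \<Sigma> - infdist y \<Sigma>\<bar>"
      using norm_triangle_ineq3[of "F t x" "F s y"] unfolding reg_def by linarith
    ultimately have 2: "\<bar>reg \<epsilon> t x - reg \<epsilon> s y\<bar> \<le> 2 * (K * D) + D"
      using KD Kts D by (simp add: algebra_simps)
    have "norm (P x - P y) \<le> norm (g2 x - g2 y) + norm (g1 x - g1 y)"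
      unfolding P_def using norm_triangle_ineq4[of "g2 x - g2 y" "g1 x - g1 y"] by (simp add: algebra_simps)
    then have 3: "norm (P x - P y) \<le> 2 * (K * D)"
      using lip1[OF x y] lip2[OF x y] KD Kts by linarith
    have "norm (Y \<epsilon> t x - Y \<epsilon> s y) = norm (sol \<epsilon> t x v* A t x - sol \<epsilon> s y v* A s y)"
      unfolding Y_def by (metis minus_diff_minus norm_minus_cancel)
    also have "\<dots> \<le> Q * (norm (A t x - A s y) + \<bar>reg \<epsilon> t x - reg \<epsilon> s y\<bar> + norm (P x - P y))"
      unfolding Q_def sol_def
      by (rule reg_field_lipschitz[OF m co[OF t x] co[OF s y] norm_A_le[OF t x] norm_A_le[OF s y] norm_P_le[OF y]])
    also have "\<dots> \<le> Q * ((6 * K + 1) * D)"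
      using 1 2 3 by (intro mult_left_mono[OF _ Q]) (simp add: algebra_simps)
    finally show ?thesis by (simp add: D_def mult.assoc)
  qed
  then show ?thesis by blast
qed

lemma field: "relative_field \<Sigma> \<rho> (K / w) (Y 0)"
proof
  show "closed \<Sigma>" "0 \<in> \<Sigma>" "\<rho> > 0" "K / w \<ge> 0"
    using \<Sigma> \<rho> K w by auto
  show "norm (Y 0 t x) \<le> K / w * infdist x \<Sigma>" if "t \<in> {0..1}" "x \<in> cball 0 \<rho>" for t x
    by (rule Y_growth[OF that])
  fix \<epsilon> :: real assume \<epsilon>: "\<epsilon> > 0"
  obtain M where M: "\<forall>t\<in>{0..1}. \<forall>s\<in>{0..1}. \<forall>x\<in>cball 0 \<rho>. \<forall>y\<in>cball 0 \<rho>.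
    norm (Y \<epsilon> t x - Y \<epsilon> s y) \<le> M * (\<bar>t - s\<bar> + norm (x - y))"
    using Y_lipschitz[OF \<epsilon>] by blast
  have "Y \<epsilon> t x = Y 0 t x" if "\<epsilon> \<le> infdist x \<Sigma>" for t x
    using that infdist_nonneg[of x \<Sigma>] by (simp add: Y_def sol_def reg_def)
  then show "\<exists>M Y'.
      (\<forall>t\<in>{0..1}. \<forall>s\<in>{0..1}. \<forall>x\<in>cball 0 \<rho>. \<forall>y\<in>cball 0 \<rho>.
         norm (Y' t x - Y' s y) \<le> M * (\<bar>t - s\<bar> + norm (x - y))) \<and>
      (\<forall>t\<in>{0..1}. \<forall>x\<in>cball 0 \<rho>. norm (Y' t x) \<le> K / w * infdist x \<Sigma>) \<and>
      (\<forall>t\<in>{0..1}. \<forall>x\<in>cball 0 \<rho>. \<epsilon> \<le> infdist x \<Sigma> \<longrightarrow> Y' t x = Y 0 t x)"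
    using M Y_growth by (intro exI[of _ M] exI[of _ "Y \<epsilon>"]) auto
qed

text \<open>Off \<Sigma> the bound \<open>K / m\<close> on \<open>l\<close> depends on the curve
  through its distance to \<Sigma>. This is enough, since both directions of Gronwall's inequality
  are used only to compare vanishing at the two ends.\<close>

lemma traj_zeros:
  assumes u: "traj \<rho> (Y 0) u"
  shows "g1 (u 0) = 0 \<longleftrightarrow> g2 (u 1) = 0"
proof (cases "u 0 \<in> \<Sigma>")
  case True
  have "u 1 = u 0"
    using relative_field.traj_const[OF field u True, of 1] by simp
  moreover have "g2 (u 0) = g1 (u 0)"
    using flat[OF trajD(1)[OF u, of 0]] True by simp
  ultimately show ?thesis by simp
next
  case False
  define e where "e = min 1 (exp (- (K / w)) * infdist (u 0) \<Sigma>)"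
  have e: "0 < e" "e \<le> 1"
    using relative_field.infdist_pos[OF field False] by (auto simp: e_def)
  define m where "m = min e (min ((e ^ r)\<^sup>2) (w * e ^ Suc r))"
  have m: "m > 0"
    using coercive_const_pos[OF e(1) m_def] .
  have co: "m * (norm v)\<^sup>2 \<le> (norm (v v* A t (u t)))\<^sup>2 + reg 0 t (u t) * (norm v)\<^sup>2" if t: "t \<in> {0..1}" for t v
    by (rule coercive[OF t trajD(1)[OF u t] e m_def])
      (use relative_field.traj_infdist[OF field u t] in \<open>auto simp: e_def min_def\<close>)
  define \<phi> where "\<phi> t = F t (u t)" for t
  have der: "(\<phi> has_vector_derivative norm (\<phi> t) *\<^sub>R sol 0 t (u t)) (at t within {0..1})"
    if t: "t \<in> {0..1}" for t
  proof -
    note ut = trajD(1)[OF u t]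
    let ?v = "Y 0 t (u t)"
    have chain: "((\<lambda>t. g (u t)) has_vector_derivative jac g (u t) *v ?v) (at t within {0..1})"
      if "g differentiable at (u t)" for g :: "real^'n \<Rightarrow> real^'p"
    proof -
      have "(g has_derivative frechet_derivative g (at (u t))) (at (u t) within u ` {0..1})"
        using that frechet_derivative_works has_derivative_at_withinI by blast
      from vector_derivative_diff_chain_within[OF trajD(2)[OF u t] this] show ?thesis
        by (simp add: o_def jac_mult[OF that])
    qed
    have "(\<phi> has_vector_derivative ((1 - t) *\<^sub>R (jac g1 (u t) *v ?v) + (- 1) *\<^sub>R g1 (u t)) +
        (t *\<^sub>R (jac g2 (u t) *v ?v) + 1 *\<^sub>R g2 (u t))) (at t within {0..1})"
      unfolding \<phi>_def F_def
      by (intro has_vector_derivative_add has_vector_derivative_scaleR chain diff1 diff2 ut)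
        (auto intro!: derivative_eq_intros)
    moreover have "((1 - t) *\<^sub>R (jac g1 (u t) *v ?v) + (- 1) *\<^sub>R g1 (u t)) +
        (t *\<^sub>R (jac g2 (u t) *v ?v) + 1 *\<^sub>R g2 (u t)) = A t (u t) *v ?v + P (u t)"
      by (simp add: A_def P_def matrix_vector_mult_add_rdistrib scaleR_matrix_vector_assoc)
    moreover have "A t (u t) *v ?v + P (u t) = reg 0 t (u t) *\<^sub>R sol 0 t (u t)"
    proof -
      have "A t (u t) *v (sol 0 t (u t) v* A t (u t)) + reg 0 t (u t) *\<^sub>R sol 0 t (u t) = P (u t)"
        unfolding sol_def by (rule reg_solve_eq[OF m co[OF t]])
      moreover have "A t (u t) *v ?v = - (A t (u t) *v (sol 0 t (u t) v* A t (u t)))"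
        unfolding Y_def by (metis linear_neg matrix_vector_mul_linear)
      ultimately show ?thesis by (simp add: algebra_simps)
    qed
    moreover have "reg 0 t (u t) = norm (\<phi> t)"
      using infdist_nonneg[of "u t" \<Sigma>] by (simp add: reg_def \<phi>_def)
    ultimately show ?thesis by simp
  qed
  have bd: "norm (norm (\<phi> t) *\<^sub>R sol 0 t (u t)) \<le> (K / m) * norm (\<phi> t)" if t: "t \<in> {0..1}" for t
  proof -
    have "m * norm (sol 0 t (u t)) \<le> K"
      using reg_solve_bound[OF m co[OF t], of "P (u t)"] norm_P_le[OF trajD(1)[OF u t]]
      unfolding sol_def by linarith
    then have "norm (sol 0 t (u t)) \<le> K / m"
      using m by (simp add: field_simps)
    then have "norm (\<phi> t) * norm (sol 0 t (u t)) \<le> norm (\<phi> t) * (K / m)"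
      by (intro mult_left_mono) auto
    then show ?thesis by (simp add: mult.commute)
  qed
  have "\<phi> 0 = 0 \<longleftrightarrow> \<phi> 1 = 0"
    using gronwall_norm[of \<phi>, OF der bd, of 1] by auto
  then show ?thesis by (simp add: \<phi>_def F_def)
qed

lemma equiv: "sigma_V_equiv \<Sigma> g1 g2"
  using relative_field.sigma_V_equiv_if_flow_zeros[OF field traj_zeros] .

end

section \<open>Uniform Kuo estimate\<close>

lemma nearest_point_in_cball:
  fixes \<Sigma> :: "'a::euclidean_space set"
  assumes "closed \<Sigma>" "0 \<in> \<Sigma>" "x \<in> cball 0 (R / 2)"
  obtains y where "y \<in> \<Sigma> \<inter> cball 0 R" "infdist x \<Sigma> = norm (x - y)"
proof -
  have "\<Sigma> \<noteq> {}" using assms(2) by auto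
  from infdist_attains_inf[OF assms(1) this] obtain y where y: "y \<in> \<Sigma>" "infdist x \<Sigma> = dist x y"
    by blast
  \<comment> \<open>As 0 lies in \<Sigma>, the nearest point satisfies
    \<open>norm y \<le> 2 * norm x\<close>; hence the passage from \<open>R\<close> to
    \<open>R / 2\<close>.\<close>
  have "dist x y \<le> norm x"
    using infdist_le[OF assms(2), of x] y(2) by simp
  then have "norm y \<le> norm x + norm x"
    using norm_triangle_ineq4[of x "x - y"] by (simp add: dist_norm)
  then show ?thesis
    using that[of y] y assms(3) by (simp add: dist_norm)
qed

lemma flat_infdist:
  fixes f g :: "'a::euclidean_space \<Rightarrow> 'b::real_normed_vector"
  assumes "closed \<Sigma>" "0 \<in> \<Sigma>" "open U" "cball 0 R \<subseteq> U" "Ck_on k f U" "Ck_on k g U"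
    and "\<And>y vs. \<lbrakk>y \<in> \<Sigma> \<inter> U; length vs < k\<rbrakk> \<Longrightarrow> dderiv f vs y = dderiv g vs y"
  shows "\<exists>K\<ge>0. \<forall>x\<in>cball 0 (R / 2). norm (f x - g x) \<le> K * infdist x \<Sigma> ^ k"
proof -
  have "\<exists>K\<ge>0. \<forall>x\<in>cball 0 R. \<forall>y\<in>\<Sigma> \<inter> cball 0 R. norm (f x - g x) \<le> K * norm (x - y) ^ k"
    using assms by (intro jet_eq_imp_flat[OF assms(3,5,6)]) auto
  then obtain K where K: "K \<ge> 0"
    "\<And>x y. \<lbrakk>x \<in> cball 0 R; y \<in> \<Sigma> \<inter> cball 0 R\<rbrakk> \<Longrightarrow> norm (f x - g x) \<le> K * norm (x - y) ^ k"
    by blast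
  have "norm (f x - g x) \<le> K * infdist x \<Sigma> ^ k" if x: "x \<in> cball 0 (R / 2)" for x
  proof -
    obtain y where y: "y \<in> \<Sigma> \<inter> cball 0 R" "infdist x \<Sigma> = norm (x - y)"
      by (rule nearest_point_in_cball[OF assms(1,2) x])
    have "x \<in> cball 0 R"
      using x norm_ge_zero[of x] unfolding mem_cball_0 by linarith
    from K(2)[OF this y(1)] y(2) show ?thesis by simp
  qed
  with K(1) show ?thesis by blast
qed

lemma flat_jac:
  fixes f g :: "real^'n \<Rightarrow> real^'p"
  assumes "closed \<Sigma>" "0 \<in> \<Sigma>" "open U" "cball 0 R \<subseteq> U" "Ck_on (Suc k) f U" "Ck_on (Suc k) g U"
    and jets: "\<And>y vs. \<lbrakk>y \<in> \<Sigma> \<inter> U; length vs < Suc k\<rbrakk> \<Longrightarrow> dderiv f vs y = dderiv g vs y"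
  shows "\<exists>K\<ge>0. \<forall>x\<in>cball 0 (R / 2). norm (jac f x - jac g x) \<le> K * infdist x \<Sigma> ^ k"
proof -
  let ?D = "\<lambda>f j x. frechet_derivative f (at x) (axis j 1)"
  have "\<exists>K\<ge>0. \<forall>x\<in>cball 0 (R / 2). norm (?D f j x - ?D g j x) \<le> K * infdist x \<Sigma> ^ k" for j
  proof (rule flat_infdist[OF assms(1-4)])
    show "Ck_on k (?D f j) U" "Ck_on k (?D g j) U"
      using assms(5,6) by auto
    show "dderiv (?D f j) vs y = dderiv (?D g j) vs y" if "y \<in> \<Sigma> \<inter> U" "length vs < k" for y vs
      using jets[of y "vs @ [axis j 1]"] that by (simp add: dderiv_snoc)
  qed
  then obtain K where K: "\<And>j. K j \<ge> 0"
    "\<And>j x. x \<in> cball 0 (R / 2) \<Longrightarrow> norm (?D f j x - ?D g j x) \<le> K j * infdist x \<Sigma> ^ k"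
    by metis
  define K' where "K' = (\<Sum>i\<in>(UNIV::'p set). \<Sum>j\<in>UNIV. K j)"
  have "norm (jac f x - jac g x) \<le> K' * infdist x \<Sigma> ^ k" if "x \<in> cball 0 (R / 2)" for x
    unfolding K'_def sum_distrib_right
    by (intro order_trans[OF norm_jac_diff_le] sum_mono K(2) that)
  moreover have "K' \<ge> 0"
    unfolding K'_def by (intro sum_nonneg K(1))
  ultimately show ?thesis by blast
qed

lemma jac_lipschitz:
  fixes g :: "real^'n \<Rightarrow> real^'p"
  assumes "open U" "Ck_on (Suc (Suc 0)) g U" "cball 0 R \<subseteq> U"
  shows "\<exists>K\<ge>0. \<forall>x\<in>cball 0 R. \<forall>y\<in>cball 0 R. norm (jac g x - jac g y) \<le> K * norm (x - y)"
proof -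
  let ?D = "\<lambda>j x. frechet_derivative g (at x) (axis j 1)"
  have "\<exists>K\<ge>0. \<forall>x\<in>cball 0 R. \<forall>y\<in>cball 0 R. norm (?D j x - ?D j y) \<le> K * norm (x - y)" for j
    using assms(2) by (intro Ck_on_lipschitz[OF assms(1) _ _ _ assms(3)]) auto
  then obtain K where K: "\<And>j. K j \<ge> 0"
    "\<And>j x y. \<lbrakk>x \<in> cball 0 R; y \<in> cball 0 R\<rbrakk> \<Longrightarrow> norm (?D j x - ?D j y) \<le> K j * norm (x - y)"
    by metis
  define K' where "K' = (\<Sum>i\<in>(UNIV::'p set). \<Sum>j\<in>UNIV. K j)"
  have "norm (jac g x - jac g y) \<le> K' * norm (x - y)" if "x \<in> cball 0 R" "y \<in> cball 0 R" for x y
    unfolding K'_def sum_distrib_right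
    by (intro order_trans[OF norm_jac_diff_le] sum_mono K(2) that)
  moreover have "K' \<ge> 0"
    unfolding K'_def by (intro sum_nonneg K(1))
  ultimately show ?thesis by blast
qed

text \<open>Writing \<open>d^r\<close> as \<open>d^\<delta> d^(r-\<delta>)\<close>, the smallness of
  \<open>d^\<delta>\<close> leaves the lower bound \<open>(K + 1) d^r\<close> after division by
  \<open>CARD('p)\<close>. The perturbation of the Jacobian consumes \<open>K d^r\<close> of
  it.\<close>

lemma kappa_bound_perturb:
  fixes f :: "real^'n \<Rightarrow> real^'p"
  assumes d: "0 < d" and C: "C > 0" and K: "0 \<le> K"
    and kappa: "C * d powr (real r - \<delta>) \<le> kappa f x"
    and small: "d powr \<delta> \<le> C / (real CARD('p) * (K + 1))"
    and J: "norm (J - jac f x) \<le> K * d ^ r"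
  shows "d ^ r * norm v \<le> norm (v v* J)"
proof -
  let ?p = "real CARD('p)"
  have p: "?p > 0" by simp
  have "?p * ((K + 1) * d ^ r) \<le> C * d powr (real r - \<delta>)"
  proof -
    have "d powr \<delta> * (?p * (K + 1)) \<le> C"
      using small p K by (simp add: pos_le_divide_eq)
    then have "d powr \<delta> * (?p * (K + 1)) * d powr (real r - \<delta>) \<le> C * d powr (real r - \<delta>)"
      by (intro mult_right_mono) auto
    moreover have "d powr \<delta> * d powr (real r - \<delta>) = d ^ r"
      using d by (simp add: powr_add[symmetric] powr_realpow)
    ultimately show ?thesis
      by (simp add: algebra_simps)
  qed
  then have "?p * ((K + 1) * d ^ r) * norm v \<le> kappa f x * norm v"
    using kappa by (intro mult_right_mono) auto
  also have "\<dots> \<le> ?p * norm (v v* jac f x)"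
    by (rule kappa_le_norm)
  finally have 1: "(K + 1) * d ^ r * norm v \<le> norm (v v* jac f x)"
    using p by (simp add: mult.assoc)
  have "norm (v v* (J - jac f x)) \<le> (K * d ^ r) * norm v"
    by (intro order_trans[OF norm_vector_matrix_mult_le] mult_right_mono J) auto
  moreover have "norm (v v* jac f x) - norm (v v* (J - jac f x)) \<le> norm (v v* J)"
    using norm_diff_ineq[of "v v* jac f x" "v v* (J - jac f x)"]
    by (simp add: vector_matrix_mult_diff_rdistrib)
  moreover have "(K + 1) * d ^ r * norm v = K * d ^ r * norm v + d ^ r * norm v"
    by (simp add: algebra_simps)
  ultimately show ?thesis
    using 1 by linarith
qed

text \<open>The Kuo condition gives constants that depend on \<open>t\<close>. For \<open>s\<close>
  near \<open>t\<close>, however, the horn of half width around the zeros of the map at time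
  \<open>s\<close> lies in the horn at time \<open>t\<close>, so the constants can be chosen locally
  uniformly.\<close>

lemma uniform_kuo:
  fixes f g1 g2 :: "real^'n \<Rightarrow> real^'p" and \<Sigma> :: "(real^'n) set"
  assumes \<Sigma>: "0 \<in> \<Sigma>" and r: "r \<ge> 1"
    and R: "R > 0" and K: "K \<ge> 0"
    and flat: "\<And>x. x \<in> cball 0 R \<Longrightarrow> norm (g2 x - g1 x) \<le> K * infdist x \<Sigma> ^ Suc r"
    and J1: "\<And>x. x \<in> cball 0 R \<Longrightarrow> norm (jac g1 x - jac f x) \<le> K * infdist x \<Sigma> ^ r"
    and J2: "\<And>x. x \<in> cball 0 R \<Longrightarrow> norm (jac g2 x - jac f x) \<le> K * infdist x \<Sigma> ^ r"
    and kuo: "\<And>t. t \<in> {0..1} \<Longrightarrow> \<exists>C \<alpha> \<delta> w. C > 0 \<and> \<alpha> > 0 \<and> \<delta> > 0 \<and> w > 0 \<and>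
       (\<forall>x \<in> horn \<Sigma> (Suc r) (\<lambda>x. (1 - t) *\<^sub>R g1 x + t *\<^sub>R g2 x) w \<inter> {x. norm x < \<alpha>}.
          kappa f x \<ge> C * infdist x \<Sigma> powr (real r - \<delta>))"
  shows "\<exists>\<alpha>>0. \<exists>w>0. \<forall>t\<in>{0..1}. \<forall>x. norm x < \<alpha> \<and>
      norm ((1 - t) *\<^sub>R g1 x + t *\<^sub>R g2 x) \<le> w * infdist x \<Sigma> ^ Suc r \<longrightarrow>
      (\<forall>v. infdist x \<Sigma> ^ r * norm v \<le> norm (v v* ((1 - t) *\<^sub>R jac g1 x + t *\<^sub>R jac g2 x)))"
proof -
  define Q where "Q t \<alpha> w \<longleftrightarrow> (\<forall>x. norm x < \<alpha> \<and>
      norm ((1 - t) *\<^sub>R g1 x + t *\<^sub>R g2 x) \<le> w * infdist x \<Sigma> ^ Suc r \<longrightarrow>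
      (\<forall>v. infdist x \<Sigma> ^ r * norm v \<le> norm (v v* ((1 - t) *\<^sub>R jac g1 x + t *\<^sub>R jac g2 x))))" for t \<alpha> w
  have Q_mono: "Q t \<alpha>' w'" if "Q t \<alpha> w" "\<alpha>' \<le> \<alpha>" "w' \<le> w" for t \<alpha> w \<alpha>' w'
    unfolding Q_def
  proof (intro allI impI, elim conjE)
    fix x v assume x: "norm x < \<alpha>'" "norm ((1 - t) *\<^sub>R g1 x + t *\<^sub>R g2 x) \<le> w' * infdist x \<Sigma> ^ Suc r"
    have "w' * infdist x \<Sigma> ^ Suc r \<le> w * infdist x \<Sigma> ^ Suc r"
      by (intro mult_right_mono that zero_le_power infdist_nonneg)
    with x that(2) have "norm x < \<alpha>" "norm ((1 - t) *\<^sub>R g1 x + t *\<^sub>R g2 x) \<le> w * infdist x \<Sigma> ^ Suc r"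
      by auto
    with that(1) show "infdist x \<Sigma> ^ r * norm v \<le> norm (v v* ((1 - t) *\<^sub>R jac g1 x + t *\<^sub>R jac g2 x))"
      unfolding Q_def by blast
  qed
  have loc: "\<exists>\<eta>>0. \<exists>\<alpha>>0. \<exists>w>0. \<forall>s\<in>{0..1}. \<bar>s - t\<bar> < \<eta> \<longrightarrow> Q s \<alpha> w" if t: "t \<in> {0..1}" for t
  proof -
    obtain C \<alpha> \<delta> w where pos: "C > 0" "\<alpha> > 0" "\<delta> > 0" "w > 0"
      and kap: "\<And>x. \<lbrakk>x \<in> horn \<Sigma> (Suc r) (\<lambda>x. (1 - t) *\<^sub>R g1 x + t *\<^sub>R g2 x) w; norm x < \<alpha>\<rbrakk> \<Longrightarrow>
          kappa f x \<ge> C * infdist x \<Sigma> powr (real r - \<delta>)"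
      using kuo[OF t] by blast
    define c where "c = C / (real CARD('p) * (K + 1))"
    have c: "c > 0" using pos K by (simp add: c_def)
    \<comment> \<open>Since \<open>d \<le> norm x\<close>, the last entry forces
      \<open>d powr \<delta> \<le> c\<close>. The choice of \<eta> makes the change of the map
      between the times \<open>s\<close> and \<open>t\<close> at most
      \<open>w / 2 * d ^ Suc r\<close>.\<close>
    define \<alpha>' where "\<alpha>' = min (min \<alpha> R) (c powr (1 / \<delta>))"
    define \<eta> where "\<eta> = w / (2 * (K + 1))"
    have "Q s \<alpha>' (w / 2)" if s: "s \<in> {0..1}" "\<bar>s - t\<bar> < \<eta>" for s
      unfolding Q_def
    proof (intro allI impI, elim conjE)
      fix x v assume x: "norm x < \<alpha>'"
        and Fs: "norm ((1 - s) *\<^sub>R g1 x + s *\<^sub>R g2 x) \<le> w / 2 * infdist x \<Sigma> ^ Suc r"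
      define d where "d = infdist x \<Sigma>"
      have d: "0 \<le> d" "d \<le> norm x"
        using infdist_nonneg infdist_le[OF \<Sigma>, of x] by (auto simp: d_def)
      have xR: "x \<in> cball 0 R" using x by (simp add: \<alpha>'_def)
      show "infdist x \<Sigma> ^ r * norm v \<le> norm (v v* ((1 - s) *\<^sub>R jac g1 x + s *\<^sub>R jac g2 x))"
      proof (cases "d = 0")
        case True
        then show ?thesis using r by (simp add: d_def power_0_left)
      next
        case False
        then have d0: "d > 0" using d by simp
        have "norm (((1 - t) *\<^sub>R g1 x + t *\<^sub>R g2 x) - ((1 - s) *\<^sub>R g1 x + s *\<^sub>R g2 x)) \<le>
            0 + \<bar>t - s\<bar> * (K * d ^ Suc r)"
          by (rule norm_convex_comb_diff_le[OF t]) (use flat[OF xR] in \<open>auto simp: d_def\<close>)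
        also have "\<dots> \<le> \<eta> * ((K + 1) * d ^ Suc r)"
        proof -
          have "K * d ^ Suc r \<le> (K + 1) * d ^ Suc r"
            using d by (intro mult_right_mono) auto
          moreover have "0 \<le> K * d ^ Suc r" using K d by simp
          ultimately have "\<bar>t - s\<bar> * (K * d ^ Suc r) \<le> \<eta> * ((K + 1) * d ^ Suc r)"
            using s K d by (intro mult_mono) auto
          then show ?thesis by simp
        qed
        also have "\<dots> = w / 2 * d ^ Suc r"
          using K by (simp add: \<eta>_def field_simps)
        finally have "norm ((1 - t) *\<^sub>R g1 x + t *\<^sub>R g2 x) \<le> w / 2 * d ^ Suc r + w / 2 * d ^ Suc r"
          using Fs norm_triangle_sub[of "(1 - t) *\<^sub>R g1 x + t *\<^sub>R g2 x" "(1 - s) *\<^sub>R g1 x + s *\<^sub>R g2 x"]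
          unfolding d_def by linarith
        then have "x \<in> horn \<Sigma> (Suc r) (\<lambda>x. (1 - t) *\<^sub>R g1 x + t *\<^sub>R g2 x) w"
          by (simp add: horn_def d_def)
        then have kx: "C * d powr (real r - \<delta>) \<le> kappa f x"
          using kap[of x] x by (simp add: d_def \<alpha>'_def)
        have "d powr \<delta> \<le> (c powr (1 / \<delta>)) powr \<delta>"
          using d x pos by (intro powr_mono2) (auto simp: \<alpha>'_def)
        also have "\<dots> = c"
          using pos c by (simp add: powr_powr)
        finally have small: "d powr \<delta> \<le> C / (real CARD('p) * (K + 1))"
          by (simp add: c_def)
        have "norm (((1 - s) *\<^sub>R jac g1 x + s *\<^sub>R jac g2 x) - ((1 - s) *\<^sub>R jac f x + s *\<^sub>R jac f x)) \<le>
            K * d ^ r + \<bar>s - s\<bar> * 0"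
          by (rule norm_convex_comb_diff_le[OF s(1)]) (use J1[OF xR] J2[OF xR] in \<open>auto simp: d_def\<close>)
        then have "norm (((1 - s) *\<^sub>R jac g1 x + s *\<^sub>R jac g2 x) - jac f x) \<le> K * d ^ r"
          by (simp add: algebra_simps)
        from kappa_bound_perturb[OF d0 pos(1) K kx small this] show ?thesis
          by (simp add: d_def)
      qed
    qed
    moreover have "\<eta> > 0" "\<alpha>' > 0" "w / 2 > 0"
      using pos K R c by (auto simp: \<eta>_def \<alpha>'_def)
    ultimately show ?thesis by blast
  qed
  \<comment> \<open>Bisection plays the role of compactness: constants of adjacent intervals combine
    by minima, thanks to \<open>Q_mono\<close>. Intersecting with the unit interval matches
    \<open>loc\<close>, which speaks of such times only.\<close>
  have "\<exists>\<alpha>>0. \<exists>w>0. \<forall>s\<in>{0..1::real} \<inter> {0..1}. Q s \<alpha> w"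
  proof (rule Bolzano[of 0 1 "\<lambda>a b. \<exists>\<alpha>>0. \<exists>w>0. \<forall>s\<in>{a..b} \<inter> {0..1}. Q s \<alpha> w"])
    fix a b c :: real
    assume "\<exists>\<alpha>>0. \<exists>w>0. \<forall>s\<in>{a..b} \<inter> {0..1}. Q s \<alpha> w"
      and "\<exists>\<alpha>>0. \<exists>w>0. \<forall>s\<in>{b..c} \<inter> {0..1}. Q s \<alpha> w"
    then obtain \<alpha>1 w1 \<alpha>2 w2 where 1: "\<alpha>1 > 0" "w1 > 0" "\<And>s. s \<in> {a..b} \<inter> {0..1} \<Longrightarrow> Q s \<alpha>1 w1"
      and 2: "\<alpha>2 > 0" "w2 > 0" "\<And>s. s \<in> {b..c} \<inter> {0..1} \<Longrightarrow> Q s \<alpha>2 w2"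
      by blast
    have "Q s (min \<alpha>1 \<alpha>2) (min w1 w2)" if "s \<in> {a..c} \<inter> {0..1}" for s
    proof (cases "s \<le> b")
      case True
      then show ?thesis using that by (intro Q_mono[OF 1(3)]) auto
    next
      case False
      then show ?thesis using that by (intro Q_mono[OF 2(3)]) auto
    qed
    then show "\<exists>\<alpha>>0. \<exists>w>0. \<forall>s\<in>{a..c} \<inter> {0..1}. Q s \<alpha> w"
      using 1 2 by (intro exI[of _ "min \<alpha>1 \<alpha>2"] conjI exI[of _ "min w1 w2"]) auto
  next
    fix t :: real assume "0 \<le> t" "t \<le> 1"
    then obtain \<eta> \<alpha> w where *: "\<eta> > 0" "\<alpha> > 0" "w > 0"
      "\<And>s. \<lbrakk>s \<in> {0..1}; \<bar>s - t\<bar> < \<eta>\<rbrakk> \<Longrightarrow> Q s \<alpha> w"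
      using loc[of t] by auto
    have "\<exists>\<alpha>>0. \<exists>w>0. \<forall>s\<in>{a..b} \<inter> {0..1}. Q s \<alpha> w" if "a \<le> t \<and> t \<le> b \<and> b - a < \<eta>" for a b
      using that * by (intro exI[of _ \<alpha>] conjI exI[of _ w] ballI) auto
    with *(1) show "\<exists>d>0. \<forall>a b. a \<le> t \<and> t \<le> b \<and> b - a < d \<longrightarrow>
        (\<exists>\<alpha>>0. \<exists>w>0. \<forall>s\<in>{a..b} \<inter> {0..1}. Q s \<alpha> w)"
      by blast
  qed simp
  then show ?thesis
    unfolding Q_def by simp
qed

section \<open>A common neighbourhood and common constants for two realisations\<close>

lemma sigma_V_equiv_of_realisations:
  fixes f g1 g2 :: "real^'n \<Rightarrow> real^'p"
  assumes \<Sigma>: "closed \<Sigma>" "0 \<in> \<Sigma>" and r: "r \<ge> 1"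
    and germs: "germ_Cs (Suc r) f" "germ_Cs (Suc r) g1" "germ_Cs (Suc r) g2"
    and jets: "rel_jet_eq r \<Sigma> g1 f" "rel_jet_eq r \<Sigma> g2 f"
    and kuo: "rel_kuo_delta \<Sigma> r f"
  shows "sigma_V_equiv \<Sigma> g1 g2"
proof -
  obtain U0 U1 U2 V1 V2 where U: "open U0" "0 \<in> U0" "Ck_on (Suc r) f U0"
      "open U1" "0 \<in> U1" "Ck_on (Suc r) g1 U1" "open U2" "0 \<in> U2" "Ck_on (Suc r) g2 U2"
    and V: "open V1" "0 \<in> V1" "\<And>y. y \<in> \<Sigma> \<inter> V1 \<Longrightarrow> jet_eq_at r g1 f y"
      "open V2" "0 \<in> V2" "\<And>y. y \<in> \<Sigma> \<inter> V2 \<Longrightarrow> jet_eq_at r g2 f y"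
    using germs jets unfolding germ_Cs_def rel_jet_eq_def by metis
  define U where "U = U0 \<inter> U1 \<inter> U2 \<inter> V1 \<inter> V2"
  have oU: "open U" and U0: "0 \<in> U" using U V by (auto simp: U_def)
  have Ck: "Ck_on (Suc r) f U" "Ck_on (Suc r) g1 U" "Ck_on (Suc r) g2 U"
    by (rule Ck_on_subset[OF U(3)] Ck_on_subset[OF U(6)] Ck_on_subset[OF U(9)]; force simp: U_def)+
  have j1: "dderiv g1 vs y = dderiv f vs y" if "y \<in> \<Sigma> \<inter> U" "length vs < Suc r" for y vs
    using V(3)[of y] that unfolding jet_eq_at_def U_def by auto
  have j2: "dderiv g2 vs y = dderiv f vs y" if "y \<in> \<Sigma> \<inter> U" "length vs < Suc r" for y vs
    using V(6)[of y] that unfolding jet_eq_at_def U_def by auto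
  obtain R where R: "R > 0" "cball 0 R \<subseteq> U"
    using oU U0 open_contains_cball by blast
  have Ck1: "Ck_on (Suc 0) g1 U" "Ck_on (Suc 0) g2 U"
    by (rule Ck_on_mono[OF Ck(2)] Ck_on_mono[OF Ck(3)]; simp)+
  have Ck2: "Ck_on (Suc (Suc 0)) g1 U" "Ck_on (Suc (Suc 0)) g2 U"
    \<comment> \<open>With \<open>r \<ge> 1\<close> the realisations are at least
      \<open>C\<^sup>2\<close>; this makes their Jacobians Lipschitz.\<close>
    using r by (auto intro: Ck_on_mono[OF Ck(2)] Ck_on_mono[OF Ck(3)] simp del: Ck_on.simps)
  obtain K1 where K1: "K1 \<ge> 0" "\<And>x. x \<in> cball 0 (R / 2) \<Longrightarrow> norm (g2 x - g1 x) \<le> K1 * infdist x \<Sigma> ^ Suc r"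
    using flat_infdist[OF \<Sigma> oU R(2) Ck(3,2)] j1 j2 by metis
  obtain K2 where K2: "K2 \<ge> 0" "\<And>x. x \<in> cball 0 (R / 2) \<Longrightarrow> norm (jac g1 x - jac f x) \<le> K2 * infdist x \<Sigma> ^ r"
    using flat_jac[OF \<Sigma> oU R(2) Ck(2,1) j1] by blast
  obtain K3 where K3: "K3 \<ge> 0" "\<And>x. x \<in> cball 0 (R / 2) \<Longrightarrow> norm (jac g2 x - jac f x) \<le> K3 * infdist x \<Sigma> ^ r"
    using flat_jac[OF \<Sigma> oU R(2) Ck(3,1) j2] by blast
  obtain K4 where K4: "K4 \<ge> 0" "\<And>x y. \<lbrakk>x \<in> cball 0 R; y \<in> cball 0 R\<rbrakk> \<Longrightarrow> norm (g1 x - g1 y) \<le> K4 * norm (x - y)"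
    using Ck_on_lipschitz[OF oU Ck1(1) compact_cball convex_cball R(2)] by blast
  obtain K5 where K5: "K5 \<ge> 0" "\<And>x y. \<lbrakk>x \<in> cball 0 R; y \<in> cball 0 R\<rbrakk> \<Longrightarrow> norm (g2 x - g2 y) \<le> K5 * norm (x - y)"
    using Ck_on_lipschitz[OF oU Ck1(2) compact_cball convex_cball R(2)] by blast
  obtain K6 where K6: "K6 \<ge> 0" "\<And>x y. \<lbrakk>x \<in> cball 0 R; y \<in> cball 0 R\<rbrakk> \<Longrightarrow> norm (jac g1 x - jac g1 y) \<le> K6 * norm (x - y)"
    using jac_lipschitz[OF oU Ck2(1) R(2)] by blast
  obtain K7 where K7: "K7 \<ge> 0" "\<And>x y. \<lbrakk>x \<in> cball 0 R; y \<in> cball 0 R\<rbrakk> \<Longrightarrow> norm (jac g2 x - jac g2 y) \<le> K7 * norm (x - y)"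
    using jac_lipschitz[OF oU Ck2(2) R(2)] by blast
  define K where "K = K1 + K2 + K3 + K4 + K5 + K6 + K7 + norm (jac g1 0) + norm (jac g2 0)"
  have K: "0 \<le> K" "K1 \<le> K" "K2 \<le> K" "K3 \<le> K" "K4 \<le> K" "K5 \<le> K" "K6 \<le> K" "K7 \<le> K"
    "K6 + norm (jac g1 0) \<le> K" "K7 + norm (jac g2 0) \<le> K"
    using K1(1) K2(1) K3(1) K4(1) K5(1) K6(1) K7(1) norm_ge_zero[of "jac g1 0"] norm_ge_zero[of "jac g2 0"]
    unfolding K_def by linarith+
  have flat: "norm (g2 x - g1 x) \<le> K * infdist x \<Sigma> ^ Suc r" if "x \<in> cball 0 (R / 2)" for x
    by (intro order_trans[OF K1(2)[OF that]] mult_right_mono K zero_le_power infdist_nonneg)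
  have J1: "norm (jac g1 x - jac f x) \<le> K * infdist x \<Sigma> ^ r" if "x \<in> cball 0 (R / 2)" for x
    by (intro order_trans[OF K2(2)[OF that]] mult_right_mono K zero_le_power infdist_nonneg)
  have J2: "norm (jac g2 x - jac f x) \<le> K * infdist x \<Sigma> ^ r" if "x \<in> cball 0 (R / 2)" for x
    by (intro order_trans[OF K3(2)[OF that]] mult_right_mono K zero_le_power infdist_nonneg)
  have "\<exists>C \<alpha> \<delta> w. C > 0 \<and> \<alpha> > 0 \<and> \<delta> > 0 \<and> w > 0 \<and>
       (\<forall>x \<in> horn \<Sigma> (Suc r) (\<lambda>x. (1 - t) *\<^sub>R g1 x + t *\<^sub>R g2 x) w \<inter> {x. norm x < \<alpha>}.
          kappa f x \<ge> C * infdist x \<Sigma> powr (real r - \<delta>))" for t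
  proof -
    let ?F = "\<lambda>x. (1 - t) *\<^sub>R g1 x + t *\<^sub>R g2 x"
    have "germ_Cs (Suc r) ?F"
      unfolding germ_Cs_def
      using Ck_on_lincomb[OF oU Ck(2,3), of "1 - t" t] oU U0 germs(2,3) by (auto simp: germ_Cs_def simp del: Ck_on.simps)
    moreover have "jet_eq_at r ?F f y" if "y \<in> \<Sigma> \<inter> U" for y
      unfolding jet_eq_at_def
    proof (intro allI impI)
      fix vs :: "(real^'n) list" assume vs: "length vs \<le> r"
      have "dderiv ?F vs y = (1 - t) *\<^sub>R dderiv g1 vs y + t *\<^sub>R dderiv g2 vs y"
        using that vs by (intro dderiv_lincomb[OF oU Ck(2,3)]) auto
      also have "\<dots> = dderiv f vs y"
        using j1[OF that] j2[OF that] vs by (simp add: algebra_simps)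
      finally show "dderiv ?F vs y = dderiv f vs y" .
    qed
    then have "rel_jet_eq r \<Sigma> ?F f"
      unfolding rel_jet_eq_def using oU U0 by blast
    ultimately show ?thesis
      using kuo unfolding rel_kuo_delta_def by blast
  qed
  then have kuo': "\<exists>\<alpha>>0. \<exists>w>0. \<forall>t\<in>{0..1}. \<forall>x. norm x < \<alpha> \<and>
      norm ((1 - t) *\<^sub>R g1 x + t *\<^sub>R g2 x) \<le> w * infdist x \<Sigma> ^ Suc r \<longrightarrow>
      (\<forall>v. infdist x \<Sigma> ^ r * norm v \<le> norm (v v* ((1 - t) *\<^sub>R jac g1 x + t *\<^sub>R jac g2 x)))"
    using uniform_kuo[OF \<Sigma>(2) r half_gt_zero[OF R(1)] K(1) flat J1 J2] by simp
  then obtain \<alpha> w where aw: "\<alpha> > 0" "w > 0"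
    and kuo_aw: "\<And>t x v. \<lbrakk>t \<in> {0..1}; norm x < \<alpha>;
      norm ((1 - t) *\<^sub>R g1 x + t *\<^sub>R g2 x) \<le> w * infdist x \<Sigma> ^ Suc r\<rbrakk> \<Longrightarrow>
      infdist x \<Sigma> ^ r * norm v \<le> norm (v v* ((1 - t) *\<^sub>R jac g1 x + t *\<^sub>R jac g2 x))"
    by blast
  \<comment> \<open>\<open>R / 2\<close> is the radius of the flatness estimates;
    \<open>\<alpha> / 2\<close> puts the closed ball inside the open one of the Kuo
    estimate.\<close>
  define \<rho> where "\<rho> = min (min 1 (R / 2)) (\<alpha> / 2)"
  have \<rho>: "\<rho> > 0" "\<rho> \<le> 1" "\<rho> \<le> R / 2" "\<rho> < \<alpha>" using R aw by (auto simp: \<rho>_def)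
  have ball: "x \<in> cball 0 (R / 2)" "x \<in> cball 0 R" "x \<in> U" "norm x \<le> 1" "norm x < \<alpha>" if "x \<in> cball 0 \<rho>" for x
    using that \<rho> R by auto
  have scale: "k * norm z \<le> K * norm z" if "k \<le> K" for k and z :: "real^'n"
    using that by (intro mult_right_mono) auto
  have Jbound: "norm (jac g x) \<le> K"
    if "k + norm (jac g 0) \<le> K" "0 \<le> k" "x \<in> cball 0 \<rho>"
      "\<And>x y. \<lbrakk>x \<in> cball 0 R; y \<in> cball 0 R\<rbrakk> \<Longrightarrow> norm (jac g x - jac g y) \<le> k * norm (x - y)"
    for g :: "real^'n \<Rightarrow> real^'p" and k x
  proof -
    have "norm (jac g x - jac g 0) \<le> k * norm (x - 0)"
      using ball[OF that(3)] R by (intro that(4)) auto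
    also have "\<dots> \<le> k * 1"
      using ball[OF that(3)] that(2) by (intro mult_left_mono) auto
    finally show ?thesis
      using that(1) norm_triangle_sub[of "jac g x" "jac g 0"] by linarith
  qed
  interpret kuo_homotopy \<Sigma> g1 g2 r \<rho> K "min w 1"
  proof
    show "closed \<Sigma>" "0 \<in> \<Sigma>" "1 \<le> r" "0 < \<rho>" "\<rho> \<le> 1" "0 < min w 1" "min w 1 \<le> 1" "0 \<le> K"
      using \<Sigma> r \<rho> aw K by auto
    fix x y :: "real^'n" assume x: "x \<in> cball 0 \<rho>"
    show "g1 differentiable at x" "g2 differentiable at x"
      using Ck_on_differentiable Ck1 oU ball(3)[OF x] by blast+
    show "norm (g2 x - g1 x) \<le> K * infdist x \<Sigma> ^ Suc r"
      by (rule flat[OF ball(1)[OF x]])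
    show "norm (jac g1 x) \<le> K" "norm (jac g2 x) \<le> K"
      using Jbound[OF K(9) K6(1) x K6(2)] Jbound[OF K(10) K7(1) x K7(2)] by auto
    assume y: "y \<in> cball 0 \<rho>"
    note xy = ball(2)[OF x] ball(2)[OF y]
    show "norm (g1 x - g1 y) \<le> K * norm (x - y)" "norm (g2 x - g2 y) \<le> K * norm (x - y)"
      "norm (jac g1 x - jac g1 y) \<le> K * norm (x - y)" "norm (jac g2 x - jac g2 y) \<le> K * norm (x - y)"
      by (intro order_trans[OF K4(2)[OF xy]] order_trans[OF K5(2)[OF xy]]
          order_trans[OF K6(2)[OF xy]] order_trans[OF K7(2)[OF xy]] scale K)+
  next
    fix t x v assume t: "t \<in> {0..1}" and x: "x \<in> cball 0 \<rho>"
      and h: "norm ((1 - t) *\<^sub>R g1 x + t *\<^sub>R g2 x) \<le> min w 1 * infdist x \<Sigma> ^ Suc r"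
    have "min w 1 * infdist x \<Sigma> ^ Suc r \<le> w * infdist x \<Sigma> ^ Suc r"
      by (intro mult_right_mono zero_le_power infdist_nonneg) simp
    then show "infdist x \<Sigma> ^ r * norm v \<le> norm (v v* ((1 - t) *\<^sub>R jac g1 x + t *\<^sub>R jac g2 x))"
      using h by (intro kuo_aw[OF t ball(5)[OF x]]) linarith
  qed
  show ?thesis by (rule equiv)
qed

theorem theorem5p9:
  fixes \<Sigma> :: "(real^'n) set" and f :: "real^'n \<Rightarrow> real^'p" and r :: nat
  assumes "closed \<Sigma>" and "0 \<in> \<Sigma>" and "r \<ge> 1"
    and "CARD('n) \<ge> CARD('p)"
    and "germ_Cs (Suc r) f"
    and "rel_kuo_delta \<Sigma> r f"
  shows "sigma_V_sufficient \<Sigma> r (Suc r) f"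
  unfolding sigma_V_sufficient_def
  using sigma_V_equiv_of_realisations[OF assms(1-3,5) _ _ _ _ assms(6)] by blast

end
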